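(* Let $d\ge2$ and $m_1,\dots,m_d$ be positive integers, where $m_1,\dots,m_\ell$ are odd and $m_{\ell+1},\dots,m_d$ are even ($0\le\ell\le d$). Let $(G,\mathcal{O})$ be the oriented Cartesian product of $(P_{m_1}\square P_{m_2},\mathcal{O}_{m_1,m_2}),(P_{m_3},\mathcal{O}_{m_3}),\dots,(P_{m_d},\mathcal{O}_{m_d})$, with all vertex weights equal to $x$ and weight $a_i$ on every $P_{m_i}$-edge. Then the partition function of the monopole-dimer model on $G$ is $$\mathcal{Z}_{m_1,\dots,m_d}=\prod_{S\subseteq[\ell]}(T_S)^{2^{d-1-\#S}},$$ where for $S=[d]\setminus\{p_1,\dots,p_r\}$, $$T_S=\prod_{i_{p_1}=1}^{\lfloor m_{p_1}/2\rfloor}\cdots\prod_{i_{p_r}=1}^{\lfloor m_{p_r}/2\rfloor}\Big(x^2+\sum_{q=1}^r4a_{p_q}^2\cos^2\frac{i_{p_q}\pi}{m_{p_q}+1}\Big),$$ and when $\ell=d$ the term $T_{[d]}$ (an empty product) is to be interpreted as $x^2$, so that its contribution $(T_{[d]})^{1/2}$ equals $x$.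
   Context: $P_n$ is the path graph on $n$ vertices labelled $1,\dots,n$ along the path, with canonical orientation $\mathcal{O}_n$ (lower to higher label). $P_{m_1}\square P_{m_2}$ has vertices $(p,q)$, embedded in the plane at $(p,q)$, with boustrophedon labelling: $(p,q)$ has label $2sm_1+p$ if $q=2s+1$ and $2sm_1-p+1$ if $q=2s$; $\mathcal{O}_{m_1,m_2}$ is the canonical orientation for this labelling. Oriented Cartesian product of naturally labelled oriented graphs $(G_1,\mathcal{O}_1),\dots,(G_k,\mathcal{O}_k)$ (here $k=d-1$, $G_1=P_{m_1}\square P_{m_2}$, $G_i=P_{m_{i+1}}$ for $i\ge2$): if $u_i\to u_i'$ in $\mathcal{O}_i$, orient $(u_1,\dots,u_i,\dots,u_k)\to(u_1,\dots,u_i',\dots,u_k)$ if $u_{i+1}+\cdots+u_k+(k-i)$ is even and reverse otherwise. A $P_{m_i}$-edge is an edge of the $d$-dimensional grid changing only the $P_{m_i}$-coordinate. Monopole-dimer model on $P=G_1\square\cdots\square G_k$ (simple plane naturally labelled $G_i$): configurations are spanning collections of vertex-disjoint directed even loops of length $\ge4$, doubled edges and isolated vertices, every vertex isolated or on exactly one loop. For a loop $L$ and $i\in[k]$, the $i$-projection is the directed closed trail in the plane multigraph on $V(G_i)$ obtained by contracting all edges of $L$ other than those changing only coordinate $i$ (parallel edges drawn enclosing no vertex). $\chi(c)$ is the number of vertices enclosed by a cycle $c$; a multiset $\mathcal{D}$ of edge-disjoint directed cycles has sign $\prod_c s_c$, $s_c=(-1)^{\chi(c)}$ if $c$ has odd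 size and is clockwise, $s_c=(-1)^{\chi(c)+1}$ otherwise. $e_i$ is the number of coordinate-$i$ edges of $L$ whose endpoints satisfy $u_{i+1}+\cdots+u_k+(k-i)$ odd. $\operatorname{sgn}(L)=-\prod_{i=1}^{k-1}(-1)^{e_i}\prod_{j=1}^k\operatorname{sgn}(\mathcal{D}_j)$, $\mathcal{D}_j$ a directed cycle decomposition of the $j$-projection with directions inherited from the trail; $w(L)=\operatorname{sgn}(L)\prod_{e\in E(L)}a_e$ (doubled edge contributes $a_e^2$); a configuration's weight is the product of its loop weights and $x$ for each isolated vertex; the partition function is the sum of configuration weights. *)

theory Defs
  imports "HOL-Complex_Analysis.Winding_Numbers" "HOL-Combinatorics.Permutations"
begin

text \<open>
  The d-dimensional grid P_{m_1} x ... x P_{m_d}.  Coordinates are indexed 1..d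
  (as in the paper); a vertex is an extensional function u with 1 <= u c <= m c.
  The oriented product has k = d-1 factors: G_1 = P_{m_1} x P_{m_2} (coordinates 1,2)
  and G_i = P_{m_(i+1)} (coordinate i+1) for 2 <= i <= k.
\<close>

definition grid_vertices :: "nat \<Rightarrow> (nat \<Rightarrow> nat) \<Rightarrow> (nat \<Rightarrow> nat) set" where
  "grid_vertices d m = PiE {1..d} (\<lambda>c. {1..m c})"

definition grid_adj :: "nat \<Rightarrow> (nat \<Rightarrow> nat) \<Rightarrow> (nat \<Rightarrow> nat) \<Rightarrow> bool" where
  "grid_adj d u v \<longleftrightarrow> (\<exists>c\<in>{1..d}. (u c = v c + 1 \<or> v c = u c + 1) \<and>
                           (\<forall>c'\<in>{1..d}. c' \<noteq> c \<longrightarrow> u c' = v c'))"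

definition edge_coord :: "nat \<Rightarrow> (nat \<Rightarrow> nat) \<Rightarrow> (nat \<Rightarrow> nat) \<Rightarrow> nat" where
  "edge_coord d u v = (THE c. c \<in> {1..d} \<and> u c \<noteq> v c)"

definition edge_weight :: "nat \<Rightarrow> (nat \<Rightarrow> real) \<Rightarrow> (nat \<Rightarrow> nat) \<Rightarrow> (nat \<Rightarrow> nat) \<Rightarrow> real" where
  "edge_weight d a u v = a (edge_coord d u v)"

text \<open>Projection of a product vertex to factor j (vertices of every factor are
  points of N x N; this is also their embedding in the plane).  Paths are drawn on
  the horizontal axis.\<close>
definition proj :: "nat \<Rightarrow> (nat \<Rightarrow> nat) \<Rightarrow> nat \<times> nat" where
  "proj j u = (if j = 1 then (u 1, u 2) else (u (j + 1), 0))"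

definition factor_vertices :: "(nat \<Rightarrow> nat) \<Rightarrow> nat \<Rightarrow> (nat \<times> nat) set" where
  "factor_vertices m j = (if j = 1 then {1..m 1} \<times> {1..m 2} else {1..m (j + 1)} \<times> {0})"

definition embed :: "nat \<times> nat \<Rightarrow> complex" where
  "embed w = Complex (real (fst w)) (real (snd w))"

text \<open>Parity quantity u_{i+1} + ... + u_k + (k - i) for factor i (k = d - 1);
  the labels u_j (j >= 2) of path vertices are the coordinates u (j+1).\<close>
definition par :: "nat \<Rightarrow> (nat \<Rightarrow> nat) \<Rightarrow> nat \<Rightarrow> nat" where
  "par d u i = (\<Sum>j\<in>{i+1..d-1}. u (j + 1)) + (d - 1 - i)"

fun poly_path :: "complex list \<Rightarrow> real \<Rightarrow> complex" where
  "poly_path [] = linepath 0 0"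
| "poly_path [z] = linepath z z"
| "poly_path [z, w] = linepath z w"
| "poly_path (z # w # rest) = linepath z w +++ poly_path (w # rest)"

definition closed_polygon :: "complex list \<Rightarrow> real \<Rightarrow> complex" where
  "closed_polygon zs = poly_path (zs @ [hd zs])"

text \<open>A closed trail in a plane multigraph is given as the list of its directed edges
  (each list entry is a distinct edge of the multigraph, parallel edges being
  distinct entries).  A directed cycle decomposition is a partition of the edge
  positions into directed cycles (lists of positions, consecutive edges chained,
  tail vertices pairwise distinct).\<close>
definition is_cycle_decomp :: "('v \<times> 'v) list \<Rightarrow> nat list list \<Rightarrow> bool" where
  "is_cycle_decomp tr D \<longleftrightarrow>
     distinct (concat D) \<and> set (concat D) = {..<length tr} \<and>
     (\<forall>c\<in>set D. c \<noteq> [] \<and>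
        distinct (map (\<lambda>e. fst (tr ! e)) c) \<and>
        (\<forall>t<length c. snd (tr ! (c ! t)) = fst (tr ! (c ! ((t + 1) mod length c)))))"

definition cycle_curve :: "((nat \<times> nat) \<times> (nat \<times> nat)) list \<Rightarrow> nat list \<Rightarrow> real \<Rightarrow> complex" where
  "cycle_curve tr c = closed_polygon (map (\<lambda>e. embed (fst (tr ! e))) c)"

definition chi :: "(nat \<times> nat) set \<Rightarrow> ((nat \<times> nat) \<times> (nat \<times> nat)) list \<Rightarrow> nat list \<Rightarrow> nat" where
  "chi V tr c = card {w\<in>V. embed w \<notin> path_image (cycle_curve tr c) \<and>
                           winding_number (cycle_curve tr c) (embed w) \<noteq> 0}"

definition clockwise :: "((nat \<times> nat) \<times> (nat \<times> nat)) list \<Rightarrow> nat list \<Rightarrow> bool" where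
  "clockwise tr c \<longleftrightarrow> (\<exists>z. z \<notin> path_image (cycle_curve tr c) \<and>
                              winding_number (cycle_curve tr c) z = -1)"

definition cycle_sign :: "(nat \<times> nat) set \<Rightarrow> ((nat \<times> nat) \<times> (nat \<times> nat)) list \<Rightarrow> nat list \<Rightarrow> real" where
  "cycle_sign V tr c =
     (if odd (length c) \<and> clockwise tr c then (-1) ^ chi V tr c else (-1) ^ (chi V tr c + 1))"

definition decomp_sign :: "(nat \<times> nat) set \<Rightarrow> ((nat \<times> nat) \<times> (nat \<times> nat)) list \<Rightarrow> real" where
  "decomp_sign V tr = prod_list (map (cycle_sign V tr) (SOME D. is_cycle_decomp tr D))"

definition loop_edges :: "'a list \<Rightarrow> ('a \<times> 'a) list" where
  "loop_edges vs = zip vs (rotate1 vs)"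

text \<open>The j-projection: the closed trail of the coordinate-j edges, other edges contracted.\<close>
definition projection :: "nat \<Rightarrow> (nat \<Rightarrow> nat) list \<Rightarrow> ((nat \<times> nat) \<times> (nat \<times> nat)) list" where
  "projection j vs = filter (\<lambda>(p, q). p \<noteq> q) (map (\<lambda>(u, v). (proj j u, proj j v)) (loop_edges vs))"

definition e_count :: "nat \<Rightarrow> nat \<Rightarrow> (nat \<Rightarrow> nat) list \<Rightarrow> nat" where
  "e_count d i vs = length (filter (\<lambda>(u, v). proj i u \<noteq> proj i v \<and> odd (par d u i)) (loop_edges vs))"

definition loop_sign :: "nat \<Rightarrow> (nat \<Rightarrow> nat) \<Rightarrow> (nat \<Rightarrow> nat) list \<Rightarrow> real" where
  "loop_sign d m vs =
     - (\<Prod>i\<in>{1..d-2}. (-1) ^ e_count d i vs) *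
       (\<Prod>j\<in>{1..d-1}. decomp_sign (factor_vertices m j) (projection j vs))"

text \<open>Weight of a loop (length >= 4) or doubled edge (length 2, weight a_e^2).\<close>
definition loop_weight :: "nat \<Rightarrow> (nat \<Rightarrow> nat) \<Rightarrow> (nat \<Rightarrow> real) \<Rightarrow> (nat \<Rightarrow> nat) list \<Rightarrow> real" where
  "loop_weight d m a vs =
     (if length vs = 2 then (edge_weight d a (vs ! 0) (vs ! 1))\<^sup>2
      else loop_sign d m vs * prod_list (map (\<lambda>(u, v). edge_weight d a u v) (loop_edges vs)))"

text \<open>Configurations are encoded as permutations sigma of the vertex set: fixed points are
  isolated vertices, 2-cycles are doubled edges, and longer cycles are the directed
  loops (u -> sigma u).\<close>
definition orbit_of :: "('a \<Rightarrow> 'a) \<Rightarrow> 'a \<Rightarrow> 'a set" where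
  "orbit_of \<sigma> v = {(\<sigma> ^^ n) v | n. True}"

definition orbit_list :: "('a \<Rightarrow> 'a) \<Rightarrow> 'a \<Rightarrow> 'a list" where
  "orbit_list \<sigma> v = map (\<lambda>t. (\<sigma> ^^ t) v) [0..<card (orbit_of \<sigma> v)]"

definition md_configs :: "nat \<Rightarrow> (nat \<Rightarrow> nat) \<Rightarrow> ((nat \<Rightarrow> nat) \<Rightarrow> (nat \<Rightarrow> nat)) set" where
  "md_configs d m = {\<sigma>. \<sigma> permutes grid_vertices d m \<and>
      (\<forall>v\<in>grid_vertices d m. \<sigma> v = v \<or> grid_adj d v (\<sigma> v)) \<and>
      (\<forall>v\<in>grid_vertices d m. card (orbit_of \<sigma> v) = 1 \<or> even (card (orbit_of \<sigma> v)))}"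

definition config_weight :: "nat \<Rightarrow> (nat \<Rightarrow> nat) \<Rightarrow> real \<Rightarrow> (nat \<Rightarrow> real) \<Rightarrow>
                             ((nat \<Rightarrow> nat) \<Rightarrow> (nat \<Rightarrow> nat)) \<Rightarrow> real" where
  "config_weight d m x a \<sigma> =
     x ^ card {v\<in>grid_vertices d m. \<sigma> v = v} *
     (\<Prod>C\<in>{orbit_of \<sigma> v | v. v \<in> grid_vertices d m \<and> \<sigma> v \<noteq> v}.
        loop_weight d m a (orbit_list \<sigma> (SOME v. v \<in> C)))"

definition md_partition_function :: "nat \<Rightarrow> (nat \<Rightarrow> nat) \<Rightarrow> real \<Rightarrow> (nat \<Rightarrow> real) \<Rightarrow> real" where
  "md_partition_function d m x a = (\<Sum>\<sigma>\<in>md_configs d m. config_weight d m x a \<sigma>)"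

definition T_S :: "nat \<Rightarrow> (nat \<Rightarrow> nat) \<Rightarrow> real \<Rightarrow> (nat \<Rightarrow> real) \<Rightarrow> nat set \<Rightarrow> real" where
  "T_S d m x a S =
     (\<Prod>i\<in>PiE ({1..d} - S) (\<lambda>p. {1..m p div 2}).
        x\<^sup>2 + (\<Sum>p\<in>{1..d} - S. 4 * (a p)\<^sup>2 * (cos (real (i p) * pi / real (m p + 1)))\<^sup>2))"

end

theory Submission
  imports
    Defs
    "HOL-Combinatorics.Cycles"
    "HOL-Combinatorics.Orbits"
    "Jordan_Normal_Form.Char_Poly"
begin

text \<open>
  The partition function is the determinant of the Kasteleyn matrix $K = x I + X$, where $X$ is the
  weighted signed adjacency matrix in which an edge in direction $c$ at $u$ carries the sign
  $\prod_{c' > c} (-1)^{u_{c'} + 1}$. All nontrivial orbits of a configuration have even length, so in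
  the Leibniz formula a loop contributes minus the product of its matrix entries. That the signs of
  these entries agree with those of the cycle decompositions of the projections is Kasteleyn's
  property for the boustrophedon orientation; it amounts to a parity form of Pick's theorem for
  lattice cycles, in which the enclosed points are counted by winding numbers.

  The parts of $X$ belonging to different directions anticommute, so $K^T K = x^2 I - X^2$ is
  diagonalised by products of sine vectors and $(\det K)^2$ is an explicit product. Collecting the
  factors that are equal under the reflections $i_c \mapsto m_c + 1 - i_c$ turns it into the square of
  the claimed product. As polynomials in $x$, both $\det K$ and the claimed product are monic, so
  they are equal.
\<close>

section \<open>Pick's theorem modulo two for lattice cycles\<close>

fun path_sum :: "('a \<Rightarrow> 'a \<Rightarrow> 'b::comm_monoid_add) \<Rightarrow> 'a list \<Rightarrow> 'b" where
  "path_sum f (a # b # r) = f a b + path_sum f (b # r)"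
| "path_sum f _ = 0"

definition cycle_sum :: "('a \<Rightarrow> 'a \<Rightarrow> 'b::comm_monoid_add) \<Rightarrow> 'a list \<Rightarrow> 'b" where
  "cycle_sum f vs = path_sum f (vs @ [hd vs])"

lemma path_sum_append:
  "path_sum f (xs @ y # ys) = path_sum f (xs @ [y]) + path_sum f (y # ys)"
proof (induction xs)
  case (Cons a xs)
  then show ?case by (cases xs) (simp_all add: add.assoc)
qed simp

lemma path_sum_snoc2: "path_sum f (xs @ [a, b]) = path_sum f (xs @ [a]) + f a b"
  using path_sum_append[of f xs a "[b]"] by simp

lemma path_sum_add: "path_sum (\<lambda>a b. f a b + g a b) vs = path_sum f vs + path_sum g vs"
  by (induction f vs rule: path_sum.induct) (simp_all add: ac_simps)

lemma path_sum_mult: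
  fixes k :: "'b::semiring_0"
  shows "path_sum (\<lambda>a b. k * f a b) vs = k * path_sum f vs"
  by (induction f vs rule: path_sum.induct) (simp_all add: algebra_simps)

lemma path_sum_sum:
  "finite A \<Longrightarrow> path_sum (\<lambda>a b. \<Sum>z\<in>A. f z a b) vs = (\<Sum>z\<in>A. path_sum (f z) vs)"
  by (induction A rule: finite_induct) (simp_all add: path_sum_add, induction vs rule: induct_list012, auto)

lemma path_sum_cong:
  assumes "successively R vs" "\<And>a b. a \<in> set vs \<Longrightarrow> b \<in> set vs \<Longrightarrow> R a b \<Longrightarrow> f a b = g a b"
  shows "path_sum f vs = path_sum g vs"
  using assms by (induction vs rule: induct_list012) auto

lemma path_sum_potential:
  fixes \<phi> :: "'a \<Rightarrow> 'b::ab_group_add"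
  shows "path_sum (\<lambda>a b. \<phi> b - \<phi> a) (v # vs) = \<phi> (last (v # vs)) - \<phi> v"
  by (induction vs arbitrary: v) (simp_all add: algebra_simps)

lemma cycle_sum_add: "cycle_sum (\<lambda>a b. f a b + g a b) vs = cycle_sum f vs + cycle_sum g vs"
  by (simp add: cycle_sum_def path_sum_add)

lemma cycle_sum_mult:
  fixes k :: "'b::semiring_0"
  shows "cycle_sum (\<lambda>a b. k * f a b) vs = k * cycle_sum f vs"
  by (simp add: cycle_sum_def path_sum_mult)

lemma cycle_sum_potential [simp]:
  fixes \<phi> :: "'a \<Rightarrow> 'b::ab_group_add"
  shows "cycle_sum (\<lambda>a b. \<phi> b - \<phi> a) vs = 0"
  by (cases vs) (simp_all add: cycle_sum_def path_sum_potential)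

lemma cycle_sum_rotate: "cycle_sum f (xs @ ys) = cycle_sum f (ys @ xs)"
proof (cases xs; cases ys)
  fix a as b bs assume "xs = a # as" "ys = b # bs"
  then show ?thesis
    using path_sum_append[of f "a # as" b "bs @ [a]"] path_sum_append[of f "b # bs" a "as @ [b]"]
    by (simp add: cycle_sum_def add.commute)
qed (simp_all add: cycle_sum_def)

definition cyclically :: "('a \<Rightarrow> 'a \<Rightarrow> bool) \<Rightarrow> 'a list \<Rightarrow> bool" where
  "cyclically R vs \<longleftrightarrow> successively R (vs @ [hd vs])"

lemma successively_join:
  "successively R (xs @ y # ys) \<longleftrightarrow> successively R (xs @ [y]) \<and> successively R (y # ys)"
  by (induction xs rule: induct_list012) auto

lemma cyclically_rotate: "cyclically R (xs @ ys) \<longleftrightarrow> cyclically R (ys @ xs)"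
proof (cases xs; cases ys)
  fix a as b bs assume "xs = a # as" "ys = b # bs"
  then show ?thesis
    using successively_append_iff[of R xs "ys @ [a]"] successively_append_iff[of R ys "xs @ [b]"]
      successively_append_iff[of R ys "[a]"] successively_append_iff[of R xs "[b]"]
    by (auto simp: cyclically_def)
qed (simp_all add: cyclically_def)

lemma cycle_sum_cong:
  assumes "cyclically R vs" "\<And>a b. a \<in> set vs \<Longrightarrow> b \<in> set vs \<Longrightarrow> R a b \<Longrightarrow> f a b = g a b"
  shows "cycle_sum f vs = cycle_sum g vs"
proof (cases "vs = []")
  case False
  then have "set (vs @ [hd vs]) \<subseteq> set vs" by auto
  then show ?thesis
    unfolding cycle_sum_def using assms by (intro path_sum_cong[of R]) (auto simp: cyclically_def)
qed (simp add: cycle_sum_def)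

type_synonym point = "nat \<times> nat"

fun unit_step :: "point \<Rightarrow> point \<Rightarrow> bool" where
  "unit_step (a, b) (c, d) \<longleftrightarrow> a = c \<and> (b = d + 1 \<or> d = b + 1) \<or> b = d \<and> (a = c + 1 \<or> c = a + 1)"

text \<open>The crossings of a walk with the horizontal ray that starts at the centre of the unit square
  with lower left corner \<open>z\<close> and points to the right.\<close>
fun crossing :: "point \<Rightarrow> point \<Rightarrow> point \<Rightarrow> int" where
  "crossing (i, j) (a, b) (c, d) =
     (if a = c \<and> i < a then (if b = j \<and> d = j + 1 then 1 else if d = j \<and> b = j + 1 then -1 else 0) else 0)"

abbreviation wind :: "point list \<Rightarrow> point \<Rightarrow> int" where
  "wind vs z \<equiv> cycle_sum (crossing z) vs"

lemma unit_step_sym: "unit_step u v \<Longrightarrow> unit_step v u"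
  by (cases u; cases v) auto

lemma crossing_swap: "crossing z b a = - crossing z a b"
  by (cases z; cases a; cases b) auto

lemma wind_right:
  assumes "cyclically unit_step vs" "(i + 1, j) \<notin> set vs \<or> (i + 1, j + 1) \<notin> set vs"
  shows "wind vs (i + 1, j) = wind vs (i, j)"
proof (rule cycle_sum_cong[OF assms(1)])
  fix a b assume "a \<in> set vs" "b \<in> set vs" "unit_step a b"
  then show "crossing (i + 1, j) a b = crossing (i, j) a b"
    using assms(2) by (cases a rule: prod.exhaust; cases b rule: prod.exhaust) (auto simp: not_less_eq less_Suc_eq)
qed

lemma wind_up:
  assumes "cyclically unit_step vs" "(i, j + 1) \<notin> set vs \<or> (i + 1, j + 1) \<notin> set vs"
  shows "wind vs (i, j + 1) = wind vs (i, j)"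
proof -
  define \<phi> :: "point \<Rightarrow> int" where "\<phi> = (\<lambda>(p, q). if q = j + 1 \<and> i < p then 1 else 0)"
  have "wind vs (i, j) = cycle_sum (\<lambda>a b. crossing (i, j + 1) a b + (\<phi> b - \<phi> a)) vs"
  proof (rule cycle_sum_cong[OF assms(1)])
    fix a b assume "a \<in> set vs" "b \<in> set vs" "unit_step a b"
    then show "crossing (i, j) a b = crossing (i, j + 1) a b + (\<phi> b - \<phi> a)"
      using assms(2) by (cases a rule: prod.exhaust; cases b rule: prod.exhaust) (auto simp: \<phi>_def less_Suc_eq)
  qed
  then show ?thesis by (simp add: cycle_sum_add)
qed

lemma wind_step:
  assumes "cyclically unit_step vs" "unit_step z z'" "z \<notin> set vs" "z' \<notin> set vs"
  shows "wind vs z = wind vs z'"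
proof -
  obtain i j i' j' where z: "z = (i, j)" "z' = (i', j')" by (cases z; cases z')
  then consider "i' = i + 1" "j' = j" | "i = i' + 1" "j' = j" | "i' = i" "j' = j + 1" | "i' = i" "j = j' + 1"
    using assms(2) by auto
  then show ?thesis
    by cases (use wind_right[OF assms(1), of i j] wind_right[OF assms(1), of i' j]
        wind_up[OF assms(1), of i j] wind_up[OF assms(1), of i j'] z assms(3,4) in auto)
qed

lemma wind_const_on_path:
  assumes "cyclically unit_step vs" "successively unit_step zs" "set zs \<inter> set vs = {}"
    "z \<in> set zs" "z' \<in> set zs"
  shows "wind vs z = wind vs z'"
proof -
  have "\<forall>z\<in>set zs. wind vs z = wind vs (hd zs)"
    using assms(2,3)
  proof (induction zs rule: induct_list012)
    case (3 x y zs)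
    then have "wind vs x = wind vs y" by (intro wind_step[OF assms(1)]) auto
    with 3 show ?case by auto
  qed auto
  then show ?thesis using assms(4,5) by metis
qed

lemma wind_lowest:
  assumes "cyclically unit_step vs" "\<forall>z\<in>set vs. j < snd z \<or> snd z = j \<and> i < fst z"
  shows "wind vs (i, j) = 0"
proof -
  define \<phi> :: "point \<Rightarrow> int" where "\<phi> = (\<lambda>(p, q). if j < q then 1 else 0)"
  have "wind vs (i, j) = cycle_sum (\<lambda>a b. \<phi> b - \<phi> a) vs"
  proof (rule cycle_sum_cong[OF assms(1)])
    fix a b assume "a \<in> set vs" "b \<in> set vs" "unit_step a b"
    then show "crossing (i, j) a b = \<phi> b - \<phi> a"
      using assms(2) by (cases a rule: prod.exhaust; cases b rule: prod.exhaust) (auto simp: \<phi>_def)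
  qed
  then show ?thesis by simp
qed

lemma length_cycle:
  assumes "cyclically unit_step vs"
  shows "int (length vs) = 2 * cycle_sum (\<lambda>a b. if fst b + snd b < fst a + snd a then 1 else 0) vs"
proof -
  define \<phi> :: "point \<Rightarrow> int" where "\<phi> = (\<lambda>(p, q). int p + int q)"
  have len: "path_sum (\<lambda>a b. 1::int) (v # us) = int (length us)" for us and v :: point
    by (induction us arbitrary: v) auto
  have "cycle_sum (\<lambda>a b. 1::int) vs
    = cycle_sum (\<lambda>a b. (\<phi> b - \<phi> a) + 2 * (if fst b + snd b < fst a + snd a then 1 else 0)) vs"
  proof (rule cycle_sum_cong[OF assms(1)])
    fix a b assume "unit_step a b"
    then show "(1::int) = (\<phi> b - \<phi> a) + 2 * (if fst b + snd b < fst a + snd a then 1 else 0)"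
      by (cases a rule: prod.exhaust; cases b rule: prod.exhaust) (auto simp: \<phi>_def)
  qed
  also have "\<dots> = 2 * cycle_sum (\<lambda>a b. if fst b + snd b < fst a + snd a then 1 else 0) vs"
    by (simp add: cycle_sum_add cycle_sum_mult)
  finally show ?thesis
    by (cases vs) (auto simp: cycle_sum_def len[where us = "_ @ [_]"])
qed

lemma even_length_cycle: "cyclically unit_step vs \<Longrightarrow> even (length vs)"
  using length_cycle[of vs] by presburger

lemma wind_unit_square:
  assumes "t = (p + 1, q) \<and> l = (p, q + 1) \<or> t = (p, q + 1) \<and> l = (p + 1, q)"
  shows "\<exists>\<epsilon>. (\<epsilon> = 1 \<or> \<epsilon> = - 1) \<and> (\<forall>z. crossing z (p, q) t + crossing z t (p + 1, q + 1)
      + crossing z (p + 1, q + 1) l + crossing z l (p, q) = (if z = (p, q) then \<epsilon> else (0::int)))"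
  using assms
proof
  assume "t = (p + 1, q) \<and> l = (p, q + 1)"
  then show ?thesis by (intro exI[of _ 1]) (auto simp: less_Suc_eq)
next
  assume "t = (p, q + 1) \<and> l = (p + 1, q)"
  then show ?thesis by (intro exI[of _ "-1"]) (auto simp: less_Suc_eq)
qed

lemma exists_lowest_corner:
  assumes "finite A" "A \<noteq> {}"
  shows "\<exists>v\<in>A. \<forall>z\<in>A. z \<noteq> v \<longrightarrow> snd v < snd z \<or> snd z = snd v \<and> fst v < fst (z :: point)"
proof -
  obtain v where v: "v \<in> A" "\<forall>z\<in>A. snd v \<le> snd z" 
    using assms ex_min_if_finite[of "snd ` A"] by (auto simp: not_less)
  define B where "B = {z\<in>A. snd z = snd v}"
  have "v \<in> B" using v(1) by (simp add: B_def)
  then have "finite B" "B \<noteq> {}" using assms(1) unfolding B_def by (simp, blast)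
  then obtain w where w: "w \<in> B" "\<forall>z\<in>B. fst w \<le> fst z"
    using ex_min_if_finite[of "fst ` B"] by (auto simp: not_less)
  have "\<forall>z\<in>A. z \<noteq> w \<longrightarrow> snd w < snd z \<or> snd z = snd w \<and> fst w < fst z"
    using v w by (force simp: B_def prod_eq_iff order_less_le)
  then show ?thesis using w B_def by blast
qed

text \<open>Parity form of Pick's theorem: cut off the lowest corner \<open>v\<close>, either by moving it to the
  opposite corner \<open>w\<close> of its unit square or, if \<open>w\<close> lies on the cycle, by splitting the cycle at \<open>w\<close>.\<close>
lemma odd_sum_wind_on_cycle:
  assumes "distinct vs" "2 \<le> length vs" "cyclically unit_step vs" "set vs \<subseteq> {..M} \<times> {..M}"
  shows "odd ((\<Sum>z\<in>set vs. wind vs z) + int (length vs div 2))"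
  using assms
proof (induction "\<Sum>z\<in>set vs. 2 * M + 1 - fst z - snd z" arbitrary: vs rule: less_induct)
  case less
  define \<mu> where "\<mu> = (\<lambda>z::point. 2 * M + 1 - fst z - snd z)"
  have IH: "odd ((\<Sum>z\<in>set us. wind us z) + int (length us div 2))"
    if "sum \<mu> (set us) < sum \<mu> (set vs)" "distinct us" "2 \<le> length us" "cyclically unit_step us"
      "set us \<subseteq> {..M} \<times> {..M}" for us
    using less.hyps[of us] that by (simp add: \<mu>_def)
  from less.prems have "set vs \<noteq> {}" by auto
  then obtain v where v: "v \<in> set vs"
    and vmin: "\<And>z. z \<in> set vs \<Longrightarrow> z \<noteq> v \<Longrightarrow> snd v < snd z \<or> snd z = snd v \<and> fst v < fst z"
    using exists_lowest_corner[of "set vs"] by (metis List.finite_set)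
  obtain as bs where "vs = as @ v # bs" using v by (meson split_list)
  define us where "us = v # bs @ as"
  have wind_us: "wind us z = wind vs z" for z
    using \<open>vs = _\<close> us_def cycle_sum_rotate[of "crossing z" as "v # bs"] by auto
  have us: "set us = set vs" "length us = length vs" "distinct us" "cyclically unit_step us"
    using less.prems \<open>vs = _\<close> us_def cyclically_rotate[of _ as "v # bs"] by auto
  obtain p q where pq: "v = (p, q)" by (cases v)
  define w where "w = (p + 1, q + 1)"
  show ?case
  proof (cases "length vs = 2")
    case True
    then obtain y where "us = [v, y]"
      using us(2) unfolding us_def by (cases "bs @ as"; cases "tl (bs @ as)") auto
    then have "wind us z = 0" for z
      by (simp add: cycle_sum_def crossing_swap[of z y v])
    then show ?thesis using True by (simp flip: wind_us)
  next
    case False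
    then have "2 \<le> length (bs @ as)" using less.prems us(2) us_def by simp
    then obtain t r where "bs @ as = t # r" "r \<noteq> []" by (cases "bs @ as") fastforce+
    then obtain mid l where us_eq: "us = v # t # mid @ [l]"
      unfolding us_def by (metis append_butlast_last_id)
    have steps: "unit_step v t" "unit_step l v" "successively unit_step (t # mid @ [l])"
      using us(4) successively_append_iff[of unit_step "[v]" "t # mid @ [l, v]"]
        successively_append_iff[of unit_step "t # mid @ [l]" "[v]"]
      unfolding us_eq cyclically_def by auto
    have neq: "v \<noteq> t" "v \<noteq> l" "t \<noteq> l" using us(3) us_eq by auto
    have tl: "t = (p + 1, q) \<and> l = (p, q + 1) \<or> t = (p, q + 1) \<and> l = (p + 1, q)"
    proof -
      have "t \<in> set vs" "l \<in> set vs" using us(1) us_eq by auto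
      with vmin[of t] vmin[of l] neq steps(1,2) show ?thesis
        unfolding pq by (cases t; cases l) auto
    qed
    have wt: "unit_step w t" "unit_step t w" "unit_step l w" "unit_step w l"
      using tl by (auto simp: w_def)
    obtain \<epsilon> where eps: "\<epsilon> = 1 \<or> \<epsilon> = - (1::int)"
      and square: "\<And>z. crossing z v t + crossing z t w + crossing z w l + crossing z l v
         = (if z = v then \<epsilon> else 0)"
      using wind_unit_square[OF tl] unfolding pq w_def by blast
    have M: "w \<in> {..M} \<times> {..M}"
      using tl less.prems(4) us(1) us_eq by (auto simp: w_def)
    have \<mu>pos: "\<mu> z > 0" if "z \<in> set vs" for z
    proof -
      have "fst z \<le> M" "snd z \<le> M" using that less.prems(4) by auto
      then show ?thesis by (simp add: \<mu>_def)
    qed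
    show ?thesis
    proof (cases "w \<in> set vs")
      case False
      define us' where "us' = w # t # mid @ [l]"
      have dist: "distinct us'" using us(1,3) False by (auto simp: us'_def us_eq)
      have wind_eq: "wind us z = wind us' z + (if z = v then \<epsilon> else 0)" for z
        using square[of z] path_sum_snoc2[of "crossing z" "t # mid" l] 
          crossing_swap[of z w t] crossing_swap[of z w l]
        by (simp add: cycle_sum_def us_eq us'_def)
      have cyc: "cyclically unit_step us'"
        using steps wt successively_append_iff[of unit_step "t # mid @ [l]" "[w]"]
        by (simp add: cyclically_def us'_def)
      have "wind us' v = 0"
      proof -
        have "\<forall>z\<in>set us'. q < snd z \<or> snd z = q \<and> p < fst z"
          using vmin us(1,3) unfolding us'_def us_eq pq by (fastforce simp: w_def)
        with cyc show ?thesis unfolding pq by (rule wind_lowest)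
      qed
      have wind_w: "wind us' w = \<epsilon>"
      proof -
        have "wind us w = wind us v"
          using wind_right[of us p q] wind_up[of us "p + 1" q] False us(1,4)
          unfolding pq w_def by auto
        with wind_eq[of w] wind_eq[of v] \<open>wind us' v = 0\<close> show ?thesis
          by (auto simp: pq w_def)
      qed
      have sets: "set vs = insert v (set us' - {w})" "v \<notin> set us'" "w \<in> set us'"
        using us(1,3) False by (auto simp: us'_def us_eq pq w_def)
      have "odd ((\<Sum>z\<in>set us'. wind us' z) + int (length us' div 2))"
      proof (rule IH)
        have "sum \<mu> (set vs) = \<mu> v + sum \<mu> (set us' - {w})"
          using sets by simp
        moreover have "sum \<mu> (set us') = \<mu> w + sum \<mu> (set us' - {w})"
          using sets by (simp add: sum.remove[of _ w])
        moreover have "\<mu> w < \<mu> v"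
          using M by (auto simp: \<mu>_def w_def pq)
        ultimately show "sum \<mu> (set us') < sum \<mu> (set vs)" by simp
        show "set us' \<subseteq> {..M} \<times> {..M}"
          using M less.prems(4) sets(1) by auto
      qed (use dist cyc in \<open>auto simp: us'_def\<close>)
      moreover have "(\<Sum>z\<in>set vs. wind vs z) = wind us v + (\<Sum>z\<in>set us' - {w}. wind us z)"
        using sets by (simp add: wind_us)
      moreover have "\<dots> = \<epsilon> + (\<Sum>z\<in>set us' - {w}. wind us' z)"
        using sets \<open>wind us' v = 0\<close> by (auto simp: wind_eq intro!: sum.cong split: if_splits)
      moreover have "(\<Sum>z\<in>set us'. wind us' z) = \<epsilon> + (\<Sum>z\<in>set us' - {w}. wind us' z)"
        using sets by (simp add: sum.remove[of _ w] wind_w)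
      moreover have "length us' = length vs" using us(2) by (simp add: us'_def us_eq)
      ultimately show ?thesis by simp
    next
      case True
      have "w \<in> set mid"
      proof -
        have "w \<in> insert v (insert t (insert l (set mid)))"
          using True us(1) by (simp add: us_eq insert_commute)
        moreover have "w \<noteq> v" "w \<noteq> t" "w \<noteq> l" using tl by (auto simp: w_def pq)
        ultimately show ?thesis by simp
      qed
      then obtain cs ds where mid: "mid = cs @ w # ds" by (meson split_list)
      define C1 where "C1 = t # cs @ [w]"
      define C2 where "C2 = w # ds @ [l]"
      have cyc: "cyclically unit_step C1" "cyclically unit_step C2"
        using steps wt successively_join[of unit_step "t # cs" w "ds @ [l]"]
          successively_join[of unit_step "t # cs" w "[t]"] successively_join[of unit_step "w # ds" l "[w]"]
        by (simp_all add: mid C1_def C2_def cyclically_def)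
      have distinct_us: "distinct (v # t # cs @ w # ds @ [l])"
        using us(3) by (simp only: us_eq mid append.simps append_assoc)
      have dist: "distinct C1" "distinct C2" and disj: "set C1 \<inter> set C2 = {w}"
        and off_v: "v \<notin> set C1" "v \<notin> set C2"
        using distinct_us by (auto simp: C1_def C2_def)
      have "set vs = set (v # t # cs @ w # ds @ [l])"
        unfolding us(1)[symmetric] us_eq mid by simp
      also have "\<dots> = insert v (set C1 \<union> set C2)"
        unfolding C1_def C2_def by auto
      finally have sets: "set vs = insert v (set C1 \<union> set C2)" "v \<notin> set C1" "v \<notin> set C2"
        using off_v by blast+
      have wind_eq: "wind us z = wind C1 z + wind C2 z + (if z = v then \<epsilon> else 0)" for z
        using square[of z] path_sum_append[of "crossing z" "v # t # cs" w "ds @ [l, v]"]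
          path_sum_append[of "crossing z" "t # cs" w "[t]"]
          path_sum_append[of "crossing z" "w # ds" l "[v]"]
          path_sum_append[of "crossing z" "w # ds" l "[w]"]
          crossing_swap[of z w t] crossing_swap[of z w l]
        by (simp add: cycle_sum_def us_eq mid C1_def C2_def)
      have low: "wind C v = 0" if "set C \<subseteq> set vs - {v}" "cyclically unit_step C" for C
        using vmin that unfolding pq by (intro wind_lowest) fastforce+
      have off1: "wind C1 z = 0" if "z \<in> insert v (set C2 - {w})" for z
      proof -
        have "wind C1 z = wind C1 v"
        proof (rule wind_const_on_path[OF cyc(1), of "ds @ [l, v]"])
          show "successively unit_step (ds @ [l, v])"
            using us(4) successively_append_iff[of unit_step "v # t # cs @ [w]" "ds @ [l, v]"]
            unfolding us_eq mid cyclically_def by simp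
          show "set (ds @ [l, v]) \<inter> set C1 = {}"
            using disj sets dist(2) by (auto simp: C2_def)
        qed (use that dist(2) in \<open>auto simp: C2_def\<close>)
        also have "\<dots> = 0" by (rule low) (use sets cyc in auto)
        finally show ?thesis .
      qed
      have off2: "wind C2 z = 0" if "z \<in> insert v (set C1 - {w})" for z
      proof -
        have "wind C2 z = wind C2 v"
        proof (rule wind_const_on_path[OF cyc(2), of "v # t # cs"])
          show "successively unit_step (v # t # cs)"
            using us(4) successively_append_iff[of unit_step "v # t # cs" "w # ds @ [l, v]"]
            unfolding us_eq mid cyclically_def by simp
          show "set (v # t # cs) \<inter> set C2 = {}"
            using disj sets dist(1) by (auto simp: C1_def)
        qed (use that dist(1) in \<open>auto simp: C1_def\<close>)
        also have "\<dots> = 0" by (rule low) (use sets cyc in auto)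
        finally show ?thesis .
      qed
      have IH': "odd ((\<Sum>z\<in>set C. wind C z) + int (length C div 2))"
        if "C = C1 \<or> C = C2" for C
      proof (rule IH)
        have "sum \<mu> (set C) \<le> sum \<mu> (set vs - {v})"
          using sets that by (intro sum_mono2) auto
        also have "\<dots> < sum \<mu> (set vs)"
          using v \<mu>pos[OF v] by (simp add: sum.remove[of _ v])
        finally show "sum \<mu> (set C) < sum \<mu> (set vs)" .
        show "distinct C" "cyclically unit_step C" using that dist cyc by blast+
        show "2 \<le> length C" using that by (auto simp: C1_def C2_def)
        show "set C \<subseteq> {..M} \<times> {..M}" using that less.prems(4) unfolding sets(1) by blast
      qed
      have w_in: "w \<in> set C1" "w \<in> set C2" by (auto simp: C1_def C2_def)
      have "(\<Sum>z\<in>set vs. wind vs z) = (\<Sum>z\<in>insert v (set C1 \<union> set C2). wind C1 z)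
         + (\<Sum>z\<in>insert v (set C1 \<union> set C2). wind C2 z) + \<epsilon>"
        using v by (simp add: wind_eq sum.distrib sum.delta flip: wind_us sets(1))
      also have "(\<Sum>z\<in>insert v (set C1 \<union> set C2). wind C1 z) = (\<Sum>z\<in>set C1. wind C1 z)"
        by (rule sum.mono_neutral_right) (use off1 w_in in auto)
      also have "(\<Sum>z\<in>insert v (set C1 \<union> set C2). wind C2 z) = (\<Sum>z\<in>set C2. wind C2 z)"
        by (rule sum.mono_neutral_right) (use off2 w_in in auto)
      finally have total: "(\<Sum>z\<in>set vs. wind vs z) = (\<Sum>z\<in>set C1. wind C1 z)
         + (\<Sum>z\<in>set C2. wind C2 z) + \<epsilon>" .
      have "length vs = length C1 + length C2"
        using us(2) by (simp add: us_eq mid C1_def C2_def)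
      then have "length vs div 2 = length C1 div 2 + length C2 div 2"
        using even_length_cycle[OF cyc(1)] by (auto elim!: evenE)
      with IH'[of C1] IH'[of C2] total eps show ?thesis by auto
    qed
  qed
qed

lemma cycle_sum_crossings_rectangle:
  assumes "cyclically unit_step vs" "set vs \<subseteq> {a1..b1} \<times> {a2..b2}"
  shows "(\<Sum>z\<in>{a1..b1} \<times> {a2..b2}. wind vs z)
    = cycle_sum (\<lambda>a b. (int (snd b) - int (snd a)) * (int (fst a) - int a1)) vs"
proof -
  have "(\<Sum>z\<in>{a1..b1} \<times> {a2..b2}. wind vs z)
     = cycle_sum (\<lambda>a b. \<Sum>z\<in>{a1..b1} \<times> {a2..b2}. crossing z a b) vs"
    unfolding cycle_sum_def by (rule path_sum_sum[symmetric]) simp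
  also have "\<dots> = cycle_sum (\<lambda>a b. (int (snd b) - int (snd a)) * (int (fst a) - int a1)) vs"
  proof (rule cycle_sum_cong[OF assms(1)])
    fix a b assume ab: "a \<in> set vs" "b \<in> set vs" "unit_step a b"
    obtain p q p' q' where eq: "a = (p, q)" "b = (p', q')" by (cases a rule: prod.exhaust; cases b rule: prod.exhaust)
    have in_rect: "p \<in> {a1..b1}" "q \<in> {a2..b2}" "q' \<in> {a2..b2}"
      using ab assms(2) eq by auto
    have "(\<Sum>z\<in>{a1..b1} \<times> {a2..b2}. crossing z a b)
      = (\<Sum>z\<in>{a1..<p} \<times> {min q q'}. int q' - int q)"
    proof (cases "p = p'")
      case True
      then have "q' = q + 1 \<or> q = q' + 1" using ab(3) eq by auto
      then show ?thesis using True in_rect unfolding eq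
        by (intro sum.mono_neutral_cong_right) (auto split: if_splits)
    next
      case False
      then show ?thesis using ab(3) eq by (simp add: case_prod_beta crossing.simps sum.neutral)
    qed
    also have "\<dots> = (int q' - int q) * (int p - int a1)"
      using in_rect by (simp add: of_nat_diff mult.commute)
    finally show "(\<Sum>z\<in>{a1..b1} \<times> {a2..b2}. crossing z a b)
      = (int (snd b) - int (snd a)) * (int (fst a) - int a1)" by (simp add: eq)
  qed
  finally show ?thesis .
qed

fun reversals :: "nat \<Rightarrow> point \<Rightarrow> point \<Rightarrow> int" where
  "reversals r (a, b) (c, d) =
     (if b = d then int (b + r) + (if a < c then 0 else 1) else if b < d then 0 else 1)"

text \<open>The winding numbers over the rectangle add up to the area \<open>\<integral> x dy\<close>, which has the parity of
  \<open>\<integral> y dx\<close>; this is what the reversals of the horizontal steps count.\<close>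
lemma even_reversals_iff:
  assumes "distinct vs" "2 \<le> length vs" "cyclically unit_step vs" "set vs \<subseteq> {a1..b1} \<times> {a2..b2}"
  shows "even (cycle_sum (reversals r) vs)
    \<longleftrightarrow> odd (\<Sum>z\<in>{a1..b1} \<times> {a2..b2} - set vs. wind vs z)"
proof -
  define D :: "point \<Rightarrow> point \<Rightarrow> int"
    where "D = (\<lambda>a b. (int (snd b) - int (snd a)) * (int (fst a) - int a1))"
  define h :: "point \<Rightarrow> point \<Rightarrow> int" where "h = (\<lambda>a b. if fst b + snd b < fst a + snd a then 1 else 0)"
  define \<phi> :: "point \<Rightarrow> int"
    where "\<phi> = (\<lambda>(p, q). int p * int q + int r * int p - int a1 * int q)"
  define k :: "point \<Rightarrow> point \<Rightarrow> int"
    where "k = (\<lambda>a b. if fst b < fst a then int (snd a + r) else - D a b)"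
  have "cycle_sum (reversals r) vs = cycle_sum (\<lambda>a b. (h a b + D a b) + ((\<phi> b - \<phi> a) + 2 * k a b)) vs"
  proof (rule cycle_sum_cong[OF assms(3)])
    fix a b assume "unit_step a b"
    then show "reversals r a b = (h a b + D a b) + ((\<phi> b - \<phi> a) + 2 * k a b)"
      by (cases a rule: prod.exhaust; cases b rule: prod.exhaust)
        (auto simp: h_def D_def \<phi>_def k_def algebra_simps)
  qed
  also have "\<dots> = cycle_sum h vs + cycle_sum D vs + 2 * cycle_sum k vs"
    by (simp add: cycle_sum_add cycle_sum_mult)
  also have "cycle_sum h vs = int (length vs div 2)"
    using length_cycle[OF assms(3)] unfolding h_def by simp
  also have "cycle_sum D vs = (\<Sum>z\<in>{a1..b1} \<times> {a2..b2}. wind vs z)"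
    unfolding D_def by (rule cycle_sum_crossings_rectangle[symmetric]) fact+
  also have "\<dots> = (\<Sum>z\<in>{a1..b1} \<times> {a2..b2} - set vs. wind vs z) + (\<Sum>z\<in>set vs. wind vs z)"
    using assms(4) by (intro sum.subset_diff) auto
  finally have "cycle_sum (reversals r) vs = (\<Sum>z\<in>{a1..b1} \<times> {a2..b2} - set vs. wind vs z)
    + ((\<Sum>z\<in>set vs. wind vs z) + int (length vs div 2)) + 2 * cycle_sum k vs" by simp
  moreover have "odd ((\<Sum>z\<in>set vs. wind vs z) + int (length vs div 2))"
    using assms by (intro odd_sum_wind_on_cycle[of _ "max b1 b2"]) force+
  ultimately show ?thesis by auto
qed

section \<open>Winding numbers of lattice curves\<close>

lemma pathstart_poly_path [simp]: "pathstart (poly_path (z # zs)) = z"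
  by (cases "z # zs" rule: poly_path.cases) auto

lemma pathfinish_poly_path [simp]: "pathfinish (poly_path (z # zs)) = last (z # zs)"
  by (induction "z # zs" arbitrary: z zs rule: poly_path.induct) auto

lemma valid_path_poly_path [simp]: "valid_path (poly_path zs)"
proof (induction zs rule: poly_path.induct)
  case (4 z w v vs)
  then show ?case by (auto intro: valid_path_join)
qed (simp_all only: poly_path.simps valid_path_linepath)

lemma path_image_poly_path:
  "2 \<le> length zs \<Longrightarrow> path_image (poly_path zs) = (\<Union>(a, b)\<in>set (zip zs (tl zs)). closed_segment a b)"
  by (induction zs rule: poly_path.induct) (auto simp: path_image_join)

lemma path_image_poly_path_map:
  assumes "2 \<le> length us"
  shows "path_image (poly_path (map f us)) = (\<Union>(a, b)\<in>set (zip us (tl us)). closed_segment (f a) (f b))"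
proof -
  have "zip (map f us) (tl (map f us)) = map (\<lambda>(a, b). (f a, f b)) (zip us (tl us))"
    by (simp add: zip_map_map flip: map_tl)
  then show ?thesis using assms by (simp add: path_image_poly_path case_prod_beta)
qed

lemma winding_number_poly_path:
  "2 \<le> length zs \<Longrightarrow> \<zeta> \<notin> path_image (poly_path zs) \<Longrightarrow>
    winding_number (poly_path zs) \<zeta> = path_sum (\<lambda>a b. winding_number (linepath a b) \<zeta>) zs"
  by (induction zs rule: poly_path.induct) (auto simp: winding_number_join path_image_join valid_path_imp_path)

lemma path_sum_map: "path_sum f (map g xs) = path_sum (\<lambda>a b. f (g a) (g b)) xs"
  by (induction xs rule: induct_list012) auto

lemma successively_zip:
  "successively R xs \<Longrightarrow> (a, b) \<in> set (zip xs (tl xs)) \<Longrightarrow> R a b"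
  by (induction xs rule: induct_list012) auto

lemma embed_eq_iff [simp]: "embed u = embed v \<longleftrightarrow> u = v"
  by (cases u; cases v) (auto simp: embed_def)

lemma unit_segment:
  assumes "unit_step u v" "z \<in> closed_segment (embed u) (embed v)"
  shows "Re z \<in> \<int> \<or> Im z \<in> \<int>"
    and "z = embed u \<or> z = embed v \<or>
      {u, v} = {(nat \<lfloor>Re z\<rfloor>, nat \<lfloor>Im z\<rfloor>), (nat \<lceil>Re z\<rceil>, nat \<lceil>Im z\<rceil>)}"
proof -
  obtain a b c d where eq: "u = (a, b)" "v = (c, d)" by (cases u rule: prod.exhaust; cases v rule: prod.exhaust)
  have fl: "\<lfloor>t\<rfloor> = int n" "\<lceil>t\<rceil> = int n + 1" if "real n < t" "t < real n + 1" for n t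
    using that by (auto intro!: floor_unique ceiling_unique)
  consider (vert) "a = c" "b = d + 1 \<or> d = b + 1" | (horiz) "b = d" "a = c + 1 \<or> c = a + 1"
    using assms(1) eq by auto
  then have "(Re z \<in> \<int> \<or> Im z \<in> \<int>) \<and> (z = embed u \<or> z = embed v \<or>
      {u, v} = {(nat \<lfloor>Re z\<rfloor>, nat \<lfloor>Im z\<rfloor>), (nat \<lceil>Re z\<rceil>, nat \<lceil>Im z\<rceil>)})"
  proof cases
    case vert
    then have z: "Re z = real a" "Im z \<in> closed_segment (real b) (real d)"
      using assms(2) eq by (auto simp: embed_def closed_segment_same_Re)
    define n where "n = min b d"
    have uv: "{u, v} = {(a, n), (a, n + 1)}"
      using vert unfolding eq n_def by auto
    have "real n \<le> Im z" "Im z \<le> real n + 1"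
      using z vert(2) by (auto simp: closed_segment_eq_real_ivl n_def)
    then consider "Im z = real n" | "Im z = real (n + 1)" | "real n < Im z" "Im z < real n + 1"
      by fastforce
    then show ?thesis
    proof cases
      case 1
      then have "z = embed (a, n)" using z by (simp add: embed_def complex_eq_iff)
      then show ?thesis using uv z by (auto simp: doubleton_eq_iff)
    next
      case 2
      then have "z = embed (a, n + 1)" using z by (simp add: embed_def complex_eq_iff)
      then show ?thesis using uv z by (auto simp: doubleton_eq_iff)
    next
      case 3
      then show ?thesis using fl[OF 3] z uv by (simp add: nat_add_distrib)
    qed
  next
    case horiz
    then have z: "Im z = real b" "Re z \<in> closed_segment (real a) (real c)"
      using assms(2) eq by (auto simp: embed_def closed_segment_same_Im)
    define n where "n = min a c"
    have uv: "{u, v} = {(n, b), (n + 1, b)}"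
      using horiz unfolding eq n_def by auto
    have "real n \<le> Re z" "Re z \<le> real n + 1"
      using z horiz(2) by (auto simp: closed_segment_eq_real_ivl n_def)
    then consider "Re z = real n" | "Re z = real (n + 1)" | "real n < Re z" "Re z < real n + 1"
      by fastforce
    then show ?thesis
    proof cases
      case 1
      then have "z = embed (n, b)" using z by (simp add: embed_def complex_eq_iff)
      then show ?thesis using uv z by (auto simp: doubleton_eq_iff)
    next
      case 2
      then have "z = embed (n + 1, b)" using z by (simp add: embed_def complex_eq_iff)
      then show ?thesis using uv z by (auto simp: doubleton_eq_iff)
    next
      case 3
      then show ?thesis using fl[OF 3] z uv by (simp add: nat_add_distrib)
    qed
  qed
  then show "Re z \<in> \<int> \<or> Im z \<in> \<int>"
    "z = embed u \<or> z = embed v \<or>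
      {u, v} = {(nat \<lfloor>Re z\<rfloor>, nat \<lfloor>Im z\<rfloor>), (nat \<lceil>Re z\<rceil>, nat \<lceil>Im z\<rceil>)}" by blast+
qed

lemma unit_step_neq: "unit_step u v \<Longrightarrow> u \<noteq> v"
  by (cases u) auto

lemma unit_segments_meet:
  assumes "unit_step u v" "unit_step a b" "{u, v} \<noteq> {a, b}"
    "z \<in> closed_segment (embed u) (embed v)" "z \<in> closed_segment (embed a) (embed b)"
  shows "\<exists>c\<in>{u, v} \<inter> {a, b}. z = embed c"
proof -
  define F where "F = (\<lambda>z. {(nat \<lfloor>Re z\<rfloor>, nat \<lfloor>Im z\<rfloor>), (nat \<lceil>Re z\<rceil>, nat \<lceil>Im z\<rceil>)})"
  have F: "F (embed w) = {w}" for w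
    by (cases w) (simp add: F_def embed_def)
  have "z = embed u \<or> z = embed v \<or> {u, v} = F z" "z = embed a \<or> z = embed b \<or> {a, b} = F z"
    unfolding F_def using unit_segment(2) assms by metis+
  moreover have "u \<noteq> v" "a \<noteq> b" using assms unit_step_neq by auto
  ultimately show ?thesis using assms(3) F by (metis (no_types, lifting) Int_iff doubleton_eq_iff insert_iff insert_absorb2)
qed

lemma lattice_point_on_unit_segment:
  assumes "unit_step a b" "embed z \<in> closed_segment (embed a) (embed b)"
  shows "z = a \<or> z = b"
  using unit_segment(2)[OF assms] by (cases z) (auto simp: embed_def)

lemma arc_poly_path:
  assumes "distinct us" "successively unit_step us" "2 \<le> length us"
  shows "arc (poly_path (map embed us))"
  using assms
proof (induction us rule: induct_list012)
  case (3 u v us)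
  show ?case
  proof (cases us)
    case Nil
    then show ?thesis using 3 by (auto intro!: arc_linepath dest: unit_step_neq)
  next
    case (Cons w ws)
    have "arc (linepath (embed u) (embed v) +++ poly_path (map embed (v # us)))"
    proof (rule arc_join)
      show "path_image (linepath (embed u) (embed v)) \<inter> path_image (poly_path (map embed (v # us)))
        \<subseteq> {pathstart (poly_path (map embed (v # us)))}"
      proof
        fix z assume z: "z \<in> path_image (linepath (embed u) (embed v)) \<inter> path_image (poly_path (map embed (v # us)))"
        moreover have "path_image (poly_path (map embed (v # us)))
          = (\<Union>(a, b)\<in>set (zip (v # us) us). closed_segment (embed a) (embed b))"
          using path_image_poly_path_map[of "v # us" embed] by (simp add: Cons)
        ultimately obtain a b where ab: "(a, b) \<in> set (zip (v # us) us)"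
          "z \<in> closed_segment (embed a) (embed b)" by blast
        then have "unit_step a b" using 3 successively_zip[of unit_step "v # us" a b] by simp
        moreover have "u \<noteq> a" "u \<noteq> b" 
          using set_zip_leftD[OF ab(1)] set_zip_rightD[OF ab(1)] 3(3) by auto
        ultimately show "z \<in> {pathstart (poly_path (map embed (v # us)))}"
          using unit_segments_meet[of u v a b z] 3 ab z by auto
      qed
    qed (use 3 Cons in \<open>auto intro!: arc_linepath dest: unit_step_neq\<close>)
    then show ?thesis by (simp add: Cons)
  qed
qed auto

definition lattice_curve :: "point list \<Rightarrow> real \<Rightarrow> complex" where
  "lattice_curve vs = closed_polygon (map embed vs)"

lemma lattice_curve_conv: "vs \<noteq> [] \<Longrightarrow> lattice_curve vs = poly_path (map embed (vs @ [hd vs]))"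
  by (simp add: lattice_curve_def closed_polygon_def hd_map)

lemma lattice_curve_closed:
  "vs \<noteq> [] \<Longrightarrow> pathfinish (lattice_curve vs) = pathstart (lattice_curve vs)"
  "vs \<noteq> [] \<Longrightarrow> valid_path (lattice_curve vs)"
  by (cases vs; simp add: lattice_curve_conv)+

lemma path_image_lattice_curve:
  "vs \<noteq> [] \<Longrightarrow> path_image (lattice_curve vs)
     = (\<Union>(a, b)\<in>set (zip (vs @ [hd vs]) (tl (vs @ [hd vs]))). closed_segment (embed a) (embed b))"
  by (subst lattice_curve_conv, assumption, rule path_image_poly_path_map) (simp add: Suc_le_eq)

lemma simple_path_lattice_curve:
  assumes "distinct vs" "cyclically unit_step vs" "3 \<le> length vs"
  shows "simple_path (lattice_curve vs)"
proof -
  obtain u v r where vs: "vs = u # v # r" "r \<noteq> []"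
    using assms(3) by (cases vs; cases "tl vs") fastforce+
  have steps: "unit_step u v" "successively unit_step (v # r @ [u])"
    using assms(2) by (auto simp: cyclically_def vs)
  have "simple_path (linepath (embed u) (embed v) +++ poly_path (map embed (v # r @ [u])))"
  proof (rule simple_path_join_loop)
    show "arc (poly_path (map embed (v # r @ [u])))"
      using assms(1) steps by (intro arc_poly_path) (auto simp: vs)
    show "path_image (linepath (embed u) (embed v)) \<inter> path_image (poly_path (map embed (v # r @ [u])))
        \<subseteq> {pathstart (linepath (embed u) (embed v)), pathstart (poly_path (map embed (v # r @ [u])))}"
    proof
      fix z assume z: "z \<in> path_image (linepath (embed u) (embed v)) \<inter> path_image (poly_path (map embed (v # r @ [u])))"
      moreover have "path_image (poly_path (map embed (v # r @ [u])))
          = (\<Union>(a, b)\<in>set (zip (v # r @ [u]) (r @ [u])). closed_segment (embed a) (embed b))"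
        using path_image_poly_path_map[of "v # r @ [u]" embed] by simp
      ultimately obtain a b where ab: "(a, b) \<in> set (zip (v # r @ [u]) (r @ [u]))"
        "z \<in> closed_segment (embed a) (embed b)" by blast
      then have "unit_step a b" using steps successively_zip[of unit_step "v # r @ [u]" a b] by simp
      moreover have "{u, v} \<noteq> {a, b}"
      proof
        assume eq: "{u, v} = {a, b}"
        obtain k where k: "k < length (r @ [u])" "a = (v # r @ [u]) ! k" "b = (r @ [u]) ! k"
          using ab(1) by (auto simp: set_zip)
        have "distinct (v # r @ [u])" using assms(1) vs by auto
        have "v \<noteq> b" using k nth_mem[OF k(1)] \<open>distinct (v # r @ [u])\<close> by auto
        then have "v = a" "u = b" using eq by (auto simp: doubleton_eq_iff)
        then have "(v # r @ [u]) ! k = (v # r @ [u]) ! 0" using k(2) by (metis nth_Cons_0)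
        then have "k = 0"
          using k(1) nth_eq_iff_index_eq[OF \<open>distinct (v # r @ [u])\<close>, of k 0] by simp
        then show False
          using k(3) vs \<open>u = b\<close> assms(1) by (cases r) auto
      qed
      ultimately show "z \<in> {pathstart (linepath (embed u) (embed v)), pathstart (poly_path (map embed (v # r @ [u])))}"
        using unit_segments_meet[of u v a b z] steps ab z by auto
    qed
  qed (use steps in \<open>auto intro!: arc_linepath dest: unit_step_neq\<close>)
  then show ?thesis
    using vs by (cases r) (simp_all add: lattice_curve_conv)
qed

definition square_centre :: "point \<Rightarrow> complex" where
  "square_centre z = Complex (real (fst z) + 1/2) (real (snd z) + 1/2)"

text \<open>Subtracting the potential \<open>\<phi>\<close> that integrates \<open>f\<close> up the left border and then along the rows leaves
  only the vertical edges that are separated from the border by the square at \<open>z\<close>.\<close>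
lemma cycle_sum_green:
  fixes f :: "point \<Rightarrow> point \<Rightarrow> 'b::comm_ring_1"
  assumes anti: "\<And>a b. f b a = - f a b"
    and square: "\<And>p q. f (p, q) (p + 1, q) + f (p + 1, q) (p + 1, q + 1) + f (p + 1, q + 1) (p, q + 1)
        + f (p, q + 1) (p, q) = (if (p, q) = z then 1 else 0)"
    and cyc: "cyclically unit_step vs"
  shows "cycle_sum f vs = of_int (wind vs z)"
proof -
  obtain i j where z: "z = (i, j)" by (cases z)
  define \<phi> where "\<phi> = (\<lambda>(p, q). (\<Sum>k<p. f (k, q) (k + 1, q)) + (\<Sum>k<q. f (0, k) (0, k + 1)))"
  have horiz: "f (p, q) (p + 1, q) = \<phi> (p + 1, q) - \<phi> (p, q)" for p q
    by (simp add: \<phi>_def)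
  have vert: "f (p, q) (p, q + 1) = (\<phi> (p, q + 1) - \<phi> (p, q)) + (if q = j \<and> i < p then 1 else 0)" for p q
  proof (induction p)
    case (Suc p)
    have "f (p + 1, q) (p + 1, q + 1) = f (p, q) (p, q + 1) + f (p, q + 1) (p + 1, q + 1) - f (p, q) (p + 1, q)
      + (if (p, q) = z then 1 else 0)"
      using square[of p q] anti[of "(p, q + 1)" "(p, q)"] anti[of "(p + 1, q + 1)" "(p, q + 1)"]
      by (simp add: algebra_simps)
    also have "\<dots> = (\<phi> (p + 1, q + 1) - \<phi> (p + 1, q)) + ((if q = j \<and> i < p then 1 else 0) + (if (p, q) = z then 1 else 0))"
      unfolding Suc.IH horiz by (simp add: algebra_simps)
    also have "(if q = j \<and> i < p then 1 else 0) + (if (p, q) = z then 1 else 0)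
      = (if q = j \<and> i < Suc p then 1 else (0::'b))"
      by (auto simp: z)
    finally show ?case by simp
  qed (simp add: \<phi>_def)
  have "cycle_sum f vs = cycle_sum (\<lambda>a b. (\<phi> b - \<phi> a) + of_int (crossing z a b)) vs"
  proof (rule cycle_sum_cong[OF cyc])
    fix a b assume ab: "unit_step a b"
    obtain p q p' q' where eq: "a = (p, q)" "b = (p', q')" by (cases a rule: prod.exhaust; cases b rule: prod.exhaust)
    consider "p' = p" "q' = q + 1" | "p' = p" "q = q' + 1" | "q' = q" "p' = p + 1" | "q' = q" "p = p' + 1"
      using ab eq by auto
    then show "f a b = (\<phi> b - \<phi> a) + of_int (crossing z a b)"
      by cases (use vert[of p q] vert[of p q'] horiz[of p q] horiz[of p' q] anti[of a b] in
        \<open>auto simp: eq z algebra_simps\<close>)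
  qed
  also have "\<dots> = cycle_sum (\<lambda>a b. of_int (crossing z a b)) vs"
    by (simp add: cycle_sum_add)
  also have "\<dots> = of_int (wind vs z)"
  proof -
    have "path_sum (\<lambda>a b. of_int (crossing z a b)) us = of_int (path_sum (crossing z) us)" for us
      by (induction us rule: induct_list012) auto
    then show ?thesis by (simp add: cycle_sum_def)
  qed
  finally show ?thesis .
qed

lemma half_integer_notin_Ints: "real n + 1/2 \<notin> \<int>"
proof
  assume "real n + 1/2 \<in> \<int>"
  then obtain k where "real n + 1/2 = of_int k" by (auto elim: Ints_cases)
  then have "real_of_int (2 * int n + 1) = real_of_int (2 * k)" by simp
  then have "2 * int n + 1 = 2 * k" by (simp only: of_int_eq_iff)
  then show False by presburger
qed

lemma square_centre_not_on_unit_segment: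
  "unit_step a b \<Longrightarrow> square_centre z \<notin> closed_segment (embed a) (embed b)"
  using unit_segment(1)[of a b "square_centre z"] half_integer_notin_Ints by (auto simp: square_centre_def)

lemma winding_number_unit_square:
  fixes p q :: nat and z :: point
  defines "f \<equiv> \<lambda>a b. winding_number (linepath (embed a) (embed b)) (square_centre z)"
  shows "f (p, q) (p + 1, q) + f (p + 1, q) (p + 1, q + 1) + f (p + 1, q + 1) (p, q + 1)
        + f (p, q + 1) (p, q) = (if (p, q) = z then 1 else 0)"
proof -
  have off: "square_centre z \<notin> closed_segment (embed a) (embed b)" if "unit_step a b" for a b
    using that by (rule square_centre_not_on_unit_segment)
  have rect: "rectpath (embed (p, q)) (embed (p + 1, q + 1)) =
     linepath (embed (p, q)) (embed (p + 1, q)) +++ linepath (embed (p + 1, q)) (embed (p + 1, q + 1)) +++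
     linepath (embed (p + 1, q + 1)) (embed (p, q + 1)) +++ linepath (embed (p, q + 1)) (embed (p, q))"
    by (simp add: rectpath_def embed_def Let_def)
  have "winding_number (rectpath (embed (p, q)) (embed (p + 1, q + 1))) (square_centre z)
     = f (p, q) (p + 1, q) + f (p + 1, q) (p + 1, q + 1) + f (p + 1, q + 1) (p, q + 1) + f (p, q + 1) (p, q)"
    unfolding rect f_def by (subst winding_number_join; simp add: path_image_join off)+
  moreover have "winding_number (rectpath (embed (p, q)) (embed (p + 1, q + 1))) (square_centre z)
     = (if (p, q) = z then 1 else 0)"
  proof (cases "(p, q) = z")
    case True
    then show ?thesis
      by (auto intro!: winding_number_rectpath simp: in_box_complex_iff embed_def square_centre_def)
  next
    case False
    then consider "fst z < p" | "p < fst z" | "snd z < q" | "q < snd z"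
      by (cases z) (auto simp: nat_neq_iff)
    then have "square_centre z \<notin> cbox (embed (p, q)) (embed (p + 1, q + 1))"
      by cases (auto simp: in_cbox_complex_iff embed_def square_centre_def)
    then show ?thesis using False
      by (auto intro!: winding_number_rectpath_outside simp: embed_def)
  qed
  ultimately show ?thesis by simp
qed

lemma winding_number_lattice_curve:
  assumes cyc: "cyclically unit_step vs" and ne: "vs \<noteq> []" and z: "z \<notin> set vs"
  shows "embed z \<notin> path_image (lattice_curve vs)"
    and "winding_number (lattice_curve vs) (embed z) = of_int (wind vs z)"
proof -
  have edge: "unit_step a b" "a \<in> set vs" "b \<in> set vs"
    if "(a, b) \<in> set (zip (vs @ [hd vs]) (tl (vs @ [hd vs])))" for a b
  proof -
    show "unit_step a b" using cyc that unfolding cyclically_def by (rule successively_zip)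
    have "a \<in> set (vs @ [hd vs])" "b \<in> set (tl (vs @ [hd vs]))"
      using that by (auto dest: set_zip_leftD set_zip_rightD)
    moreover have "set (tl (vs @ [hd vs])) \<subseteq> set (vs @ [hd vs])" by (rule list.set_sel(2)[THEN subsetI]) auto
    ultimately show "a \<in> set vs" "b \<in> set vs" using ne by auto
  qed
  have seg: "closed_segment (embed z) (square_centre z) \<inter> path_image (lattice_curve vs) = {}"
  proof (rule ccontr)
    assume "closed_segment (embed z) (square_centre z) \<inter> path_image (lattice_curve vs) \<noteq> {}"
    then obtain w a b where w: "w \<in> closed_segment (embed z) (square_centre z)"
        "w \<in> closed_segment (embed a) (embed b)" 
        and ab: "(a, b) \<in> set (zip (vs @ [hd vs]) (tl (vs @ [hd vs])))"
      by (auto simp: path_image_lattice_curve ne)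
    then obtain t where t: "0 \<le> t" "t \<le> 1" "w = (1 - t) *\<^sub>R embed z + t *\<^sub>R square_centre z"
      by (auto simp: closed_segment_def)
    then have coords: "Re w = real (fst z) + t / 2" "Im w = real (snd z) + t / 2"
      unfolding t(3) by (simp_all add: embed_def square_centre_def algebra_simps)
    have "Re w \<in> \<int> \<or> Im w \<in> \<int>" using unit_segment(1) edge(1)[OF ab] w by blast
    then have "t / 2 \<in> \<int>" using coords
      by (metis Ints_diff Ints_of_nat add_diff_cancel_left')
    then obtain k where "t / 2 = of_int k" by (auto elim: Ints_cases)
    with t have "-1 < real_of_int k" "real_of_int k < 1" by linarith+
    then have "k = 0" by linarith
    then have "t = 0" using \<open>t / 2 = _\<close> by simp
    then have "w = embed z" using t(3) by simp
    then have "z = a \<or> z = b" using lattice_point_on_unit_segment edge(1)[OF ab] w by blast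
    then show False using z edge[OF ab] by auto
  qed
  then show "embed z \<notin> path_image (lattice_curve vs)" by auto
  have "winding_number (lattice_curve vs) (embed z) = winding_number (lattice_curve vs) (square_centre z)"
    using seg lattice_curve_closed[OF ne]
    by (intro winding_number_eq[where S = "closed_segment (embed z) (square_centre z)"])
       (auto simp: valid_path_imp_path)
  also have "\<dots> = cycle_sum (\<lambda>a b. winding_number (linepath (embed a) (embed b)) (square_centre z)) vs"
  proof -
    have "square_centre z \<notin> path_image (lattice_curve vs)" using seg by auto
    then show ?thesis
      using ne by (simp add: lattice_curve_conv winding_number_poly_path path_sum_map cycle_sum_def
          Suc_le_eq del: map_append list.map)
  qed
  also have "\<dots> = cycle_sum (\<lambda>a b. if unit_step a b then winding_number (linepath (embed a) (embed b)) (square_centre z) else 0) vs"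
    by (rule cycle_sum_cong[OF cyc]) simp
  also have "\<dots> = of_int (wind vs z)"
  proof (rule cycle_sum_green[OF _ _ cyc])
    fix a b
    have "winding_number (linepath (embed b) (embed a)) (square_centre z)
      = - winding_number (linepath (embed a) (embed b)) (square_centre z)" if "unit_step a b"
      using winding_number_reversepath[of "linepath (embed a) (embed b)" "square_centre z"]
        square_centre_not_on_unit_segment[OF that] by simp
    then show "(if unit_step b a then winding_number (linepath (embed b) (embed a)) (square_centre z) else 0)
      = - (if unit_step a b then winding_number (linepath (embed a) (embed b)) (square_centre z) else 0)"
      using unit_step_sym by auto
  qed (use winding_number_unit_square[of _ _ z] in auto)
  finally show "winding_number (lattice_curve vs) (embed z) = of_int (wind vs z)" .
qed

lemma wind_two:
  assumes "length vs = 2"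
  shows "wind vs z = 0"
proof -
  obtain a b where "vs = [a, b]" using assms by (auto simp: numeral_2_eq_2 length_Suc_conv)
  then show ?thesis by (simp add: cycle_sum_def crossing_swap[of z b a])
qed

lemma wind_cases:
  assumes "distinct vs" "cyclically unit_step vs" "2 \<le> length vs" "z \<notin> set vs"
  shows "wind vs z \<in> {-1, 0, 1}"
proof (cases "length vs = 2")
  case True
  then show ?thesis by (simp add: wind_two)
next
  case False
  then have ne: "vs \<noteq> []" "3 \<le> length vs" using assms(3) by auto
  have "winding_number (lattice_curve vs) (embed z) \<in> {-1, 0, 1}"
    using assms ne winding_number_lattice_curve(1) lattice_curve_closed
    by (intro simple_closed_path_winding_number_cases simple_path_lattice_curve) auto
  then have "(of_int (wind vs z) :: complex) \<in> {of_int (-1), of_int 0, of_int 1}"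
    using winding_number_lattice_curve(2)[OF assms(2) ne(1) assms(4)] by simp
  then show ?thesis by (simp only: insert_iff of_int_eq_iff empty_iff)
qed

lemma vertex_on_lattice_curve:
  assumes "z \<in> set vs"
  shows "embed z \<in> path_image (lattice_curve vs)"
proof -
  have ne: "vs \<noteq> []" using assms by auto
  obtain k where k: "k < length vs" "z = vs ! k" using assms by (metis in_set_conv_nth)
  then have "(z, (tl (vs @ [hd vs])) ! k) \<in> set (zip (vs @ [hd vs]) (tl (vs @ [hd vs])))"
    by (auto simp: set_zip nth_append intro!: exI[of _ k])
  then show ?thesis by (subst path_image_lattice_curve[OF ne]) auto
qed

lemma even_enclosed_iff:
  assumes "distinct vs" "cyclically unit_step vs" "2 \<le> length vs" "finite V"
  shows "even (card {w\<in>V. embed w \<notin> path_image (lattice_curve vs) \<and>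
                           winding_number (lattice_curve vs) (embed w) \<noteq> 0})
    \<longleftrightarrow> even (\<Sum>z\<in>V - set vs. wind vs z)"
proof -
  have "vs \<noteq> []" using assms by auto
  then have "{w\<in>V. embed w \<notin> path_image (lattice_curve vs) \<and>
      winding_number (lattice_curve vs) (embed w) \<noteq> 0} = {w\<in>V - set vs. odd (wind vs w)}"
    using winding_number_lattice_curve[OF assms(2)] vertex_on_lattice_curve wind_cases[OF assms(1-3)]
    by fastforce
  then show ?thesis using even_sum_iff[of "V - set vs" "wind vs"] assms(4) by simp
qed

section \<open>Signs of cycle decompositions\<close>

lemma path_sum_conv_sum_list: "path_sum f vs = sum_list (map (\<lambda>(a, b). f a b) (zip vs (tl vs)))"
  by (induction vs rule: induct_list012) auto

lemma successively_conv_zip: "successively R vs \<longleftrightarrow> (\<forall>(a, b)\<in>set (zip vs (tl vs)). R a b)"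
  by (induction vs rule: induct_list012) auto

lemma zip_closed: "zip (vs @ [hd vs]) (tl (vs @ [hd vs])) = (if vs = [] then [] else loop_edges vs)"
proof (cases vs)
  case (Cons a xs)
  then show ?thesis using zip_append[of "a # xs" "xs @ [a]" "[a]" "[]"] by (simp add: loop_edges_def)
qed simp

lemma cycle_sum_conv_loop_edges: "cycle_sum f vs = sum_list (map (\<lambda>(a, b). f a b) (loop_edges vs))"
  unfolding cycle_sum_def path_sum_conv_sum_list zip_closed by (simp add: loop_edges_def)

lemma cyclically_conv_loop_edges: "cyclically R vs \<longleftrightarrow> (\<forall>(a, b)\<in>set (loop_edges vs). R a b)"
  unfolding cyclically_def successively_conv_zip zip_closed by (simp add: loop_edges_def)

definition edge_sign :: "nat \<Rightarrow> point \<Rightarrow> point \<Rightarrow> real" where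
  "edge_sign r a b = (if even (reversals r a b) then 1 else -1)"

lemma prod_list_signs:
  "prod_list (map (\<lambda>e. if even (f e) then 1 else -1) xs) = (if even (sum_list (map f xs)) then 1 else (-1::real))"
  for f :: "'a \<Rightarrow> int"
  by (induction xs) auto

lemma cycle_edges:
  assumes "c \<noteq> []" "\<forall>k<length c. snd (tr ! (c ! k)) = fst (tr ! (c ! ((k + 1) mod length c)))"
  shows "map (\<lambda>e. tr ! e) c = loop_edges (map (\<lambda>e. fst (tr ! e)) c)"
  by (rule nth_equalityI) (use assms in \<open>auto simp: loop_edges_def nth_rotate1 prod_eq_iff\<close>)

lemma cycle_sign_eq_prod_edge_sign:
  assumes c: "c \<noteq> []" "distinct (map (\<lambda>e. fst (tr ! e)) c)"
      "\<forall>k<length c. snd (tr ! (c ! k)) = fst (tr ! (c ! ((k + 1) mod length c)))"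
    and step: "\<forall>e\<in>set c. unit_step (fst (tr ! e)) (snd (tr ! e))"
    and V: "V = {a1..b1} \<times> {a2..b2}" "\<forall>e\<in>set c. fst (tr ! e) \<in> V"
  shows "cycle_sign V tr c = prod_list (map (\<lambda>e. edge_sign r (fst (tr ! e)) (snd (tr ! e))) c)"
proof -
  define vs where "vs = map (\<lambda>e. fst (tr ! e)) c"
  have edges: "map (\<lambda>e. tr ! e) c = loop_edges vs"
    unfolding vs_def by (rule cycle_edges) fact+
  have dist: "distinct vs" and sub: "set vs \<subseteq> {a1..b1} \<times> {a2..b2}" and fin: "finite V"
    using c V by (auto simp: vs_def)
  have cyc: "cyclically unit_step vs"
    unfolding cyclically_conv_loop_edges edges[symmetric] using step by (auto simp: case_prod_beta)
  have "even (length vs)" using even_length_cycle[OF cyc] .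
  moreover have "length vs \<noteq> 0" using c(1) by (simp add: vs_def)
  ultimately have len: "2 \<le> length vs" by presburger
  have curve: "cycle_curve tr c = lattice_curve vs"
    by (simp add: cycle_curve_def lattice_curve_def vs_def comp_def)
  have "even (chi V tr c) \<longleftrightarrow> even (\<Sum>z\<in>V - set vs. wind vs z)"
    unfolding chi_def curve by (rule even_enclosed_iff) fact+
  also have "\<dots> \<longleftrightarrow> odd (cycle_sum (reversals r) vs)"
    using even_reversals_iff[OF dist len cyc sub, of r] by (simp add: V(1))
  finally have parity: "even (chi V tr c) \<longleftrightarrow> odd (cycle_sum (reversals r) vs)" .
  have "cycle_sign V tr c = (-1) ^ (chi V tr c + 1)"
    using \<open>even (length vs)\<close> by (simp add: cycle_sign_def vs_def)
  also have "\<dots> = (if even (cycle_sum (reversals r) vs) then 1 else -1)"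
    using parity by auto
  also have "cycle_sum (reversals r) vs = sum_list (map (\<lambda>e. reversals r (fst (tr ! e)) (snd (tr ! e))) c)"
    unfolding cycle_sum_conv_loop_edges edges[symmetric] by (simp add: comp_def case_prod_beta)
  finally show ?thesis
    by (simp add: edge_sign_def prod_list_signs)
qed

lemma exists_simple_cycle:
  fixes s t :: "'e \<Rightarrow> 'v"
  assumes "finite I" "e0 \<in> I" "\<And>e. e \<in> I \<Longrightarrow> \<exists>e'\<in>I. s e' = t e"
  shows "\<exists>c. c \<noteq> [] \<and> set c \<subseteq> I \<and> distinct (map s c) \<and>
    (\<forall>k<length c. t (c ! k) = s (c ! ((k + 1) mod length c)))"
proof -
  obtain nx where nx: "\<And>e. e \<in> I \<Longrightarrow> nx e \<in> I \<and> s (nx e) = t e"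
    using assms(3) by metis
  define w where "w = (\<lambda>k. (nx ^^ k) e0)"
  have w: "w k \<in> I" for k
    by (induction k) (use assms(2) nx in \<open>auto simp: w_def\<close>)
  have w_step: "t (w k) = s (w (Suc k))" for k
    using nx[OF w[of k]] by (simp add: w_def)
  have "\<not> inj_on (s \<circ> w) {..card (s ` I)}"
  proof
    assume inj: "inj_on (s \<circ> w) {..card (s ` I)}"
    have "card ((s \<circ> w) ` {..card (s ` I)}) \<le> card (s ` I)"
      using w assms(1) by (intro card_mono) auto
    then show False using card_image[OF inj] by simp
  qed
  then have ex: "\<exists>j i. i < j \<and> s (w i) = s (w j)"
    by (auto simp: inj_on_def) (metis linorder_neqE_nat)
  define j where "j = (LEAST j. \<exists>i<j. s (w i) = s (w j))"
  have "\<exists>i<j. s (w i) = s (w j)"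
    unfolding j_def by (rule LeastI_ex) (use ex in blast)
  then obtain i where i: "i < j" "s (w i) = s (w j)" by blast
  have inj: "inj_on (s \<circ> w) {..<j}"
  proof (rule linorder_inj_onI)
    fix p q assume "p < q" "p \<in> {..<j}" "q \<in> {..<j}"
    then show "(s \<circ> w) p \<noteq> (s \<circ> w) q"
      using not_less_Least[of q "\<lambda>j. \<exists>i<j. s (w i) = s (w j)"] by (auto simp: j_def)
  qed auto
  define c where "c = map w [i..<j]"
  have "t (c ! k) = s (c ! ((k + 1) mod length c))" if "k < length c" for k
  proof (cases "k + 1 = length c")
    case True
    then have "i + k + 1 = j" by (simp add: c_def)
    then show ?thesis using True i by (simp add: c_def w_step del: upt_Suc)
  next
    case False
    then show ?thesis using that by (simp add: c_def w_step)
  qed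
  moreover have "distinct (map s c)"
    using inj by (auto simp: c_def distinct_map inj_on_def)
  moreover have "c \<noteq> []" "set c \<subseteq> I" using i w by (auto simp: c_def)
  ultimately show ?thesis by blast
qed

lemma mset_rotate1: "mset (rotate1 xs) = mset xs"
  by (cases xs) auto

lemma exists_cycle_partition:
  fixes s t :: "nat \<Rightarrow> 'v"
  assumes "finite I" "image_mset s (mset_set I) = image_mset t (mset_set I)"
  shows "\<exists>D. distinct (concat D) \<and> set (concat D) = I \<and> (\<forall>c\<in>set D. c \<noteq> [] \<and> distinct (map s c) \<and>
    (\<forall>k<length c. t (c ! k) = s (c ! ((k + 1) mod length c))))"
  using assms
proof (induction "card I" arbitrary: I rule: less_induct)
  case less
  show ?case
  proof (cases "I = {}")
    case True
    then show ?thesis by (intro exI[of _ "[]"]) auto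
  next
    case False
    then obtain e0 where "e0 \<in> I" by blast
    have succ: "\<exists>e'\<in>I. s e' = t e" if "e \<in> I" for e
    proof -
      have "t e \<in># image_mset t (mset_set I)" using that less.prems(1) by auto
      then have "t e \<in># image_mset s (mset_set I)" using less.prems(2) by simp
      then show ?thesis using less.prems(1) by auto
    qed
    obtain c where c: "c \<noteq> []" "set c \<subseteq> I" "distinct (map s c)"
        "\<forall>k<length c. t (c ! k) = s (c ! ((k + 1) mod length c))"
      using exists_simple_cycle[of I e0 s t, OF less.prems(1) \<open>e0 \<in> I\<close> succ] by auto
    have "map t c = rotate1 (map s c)"
      by (rule nth_equalityI) (use c in \<open>auto simp: nth_rotate1\<close>)
    then have "mset (map t c) = mset (map s c)" by (simp only: mset_rotate1)
    moreover have "mset c = mset_set (set c)"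
      using c(3) by (simp add: distinct_map mset_set_set)
    ultimately have bal_c: "image_mset s (mset_set (set c)) = image_mset t (mset_set (set c))"
      by simp
    have "mset_set I = mset_set (I - set c) + mset_set (set c)"
      using mset_set_Union[of "I - set c" "set c"] less.prems(1) c(2) by (auto simp: Un_absorb2)
    then have "image_mset s (mset_set (I - set c)) = image_mset t (mset_set (I - set c))"
      using less.prems(2) bal_c by simp
    moreover have "card (I - set c) < card I"
    proof (rule psubset_card_mono[OF less.prems(1)])
      have "hd c \<in> set c" using c(1) by simp
      then show "I - set c \<subset> I" using c(2) by blast
    qed
    ultimately obtain D where D: "distinct (concat D)" "set (concat D) = I - set c"
       "\<forall>c\<in>set D. c \<noteq> [] \<and> distinct (map s c) \<and>
        (\<forall>k<length c. t (c ! k) = s (c ! ((k + 1) mod length c)))"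
      using less.hyps[of "I - set c"] less.prems(1) by auto
    show ?thesis
      by (intro exI[of _ "c # D"]) (use c D in \<open>auto simp: distinct_map\<close>)
  qed
qed

lemma exists_cycle_decomp:
  assumes "mset (map fst tr) = mset (map snd tr)"
  shows "\<exists>D. is_cycle_decomp tr D"
proof -
  have "image_mset (\<lambda>e. g (tr ! e)) (mset_set {..<length tr}) = mset (map g tr)" for g :: "'a \<times> 'a \<Rightarrow> 'a"
  proof -
    have "mset_set {..<length tr} = mset [0..<length tr]"
      by (rule mset_set_upto_eq_mset_upto)
    also have "image_mset (\<lambda>e. g (tr ! e)) \<dots> = mset (map g (map (\<lambda>e. tr ! e) [0..<length tr]))"
      by (simp add: comp_def del: mset_upt)
    finally show ?thesis by (simp only: map_nth)
  qed
  from this[of fst] this[of snd] assms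
  have "image_mset (\<lambda>e. fst (tr ! e)) (mset_set {..<length tr}) = image_mset (\<lambda>e. snd (tr ! e)) (mset_set {..<length tr})"
    by simp
  from exists_cycle_partition[OF _ this] show ?thesis
    unfolding is_cycle_decomp_def by blast
qed

lemma decomp_sign_eq_prod_edge_sign:
  assumes bal: "mset (map fst tr) = mset (map snd tr)"
    and step: "\<forall>(a, b)\<in>set tr. unit_step a b \<and> a \<in> V"
    and V: "V = {a1..b1} \<times> {a2..b2}"
  shows "decomp_sign V tr = prod_list (map (\<lambda>(a, b). edge_sign r a b) tr)"
proof -
  define D where "D = (SOME D. is_cycle_decomp tr D)"
  define g where "g = (\<lambda>e. edge_sign r (fst (tr ! e)) (snd (tr ! e)))"
  have "is_cycle_decomp tr D"
    unfolding D_def using exists_cycle_decomp[OF bal] by (rule someI_ex)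
  then have D: "distinct (concat D)" "set (concat D) = {..<length tr}"
    "\<And>c. c \<in> set D \<Longrightarrow> c \<noteq> [] \<and> distinct (map (\<lambda>e. fst (tr ! e)) c) \<and>
        (\<forall>t<length c. snd (tr ! (c ! t)) = fst (tr ! (c ! ((t + 1) mod length c))))"
    unfolding is_cycle_decomp_def by blast+
  have "cycle_sign V tr c = prod_list (map g c)" if "c \<in> set D" for c
  proof -
    have lt: "e < length tr" if "e \<in> set c" for e
      using D(2) that \<open>c \<in> set D\<close> by auto
    have "unit_step (fst (tr ! e)) (snd (tr ! e)) \<and> fst (tr ! e) \<in> V" if "e \<in> set c" for e
      using bspec[OF step, OF nth_mem[OF lt[OF that]]] by (simp add: case_prod_beta)
    then have "\<forall>e\<in>set c. unit_step (fst (tr ! e)) (snd (tr ! e))" "\<forall>e\<in>set c. fst (tr ! e) \<in> V"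
      by blast+
    then show ?thesis
      unfolding g_def using D(3)[OF that] V by (intro cycle_sign_eq_prod_edge_sign) blast+
  qed
  then have "decomp_sign V tr = prod_list (map (\<lambda>c. prod_list (map g c)) D)"
    unfolding decomp_sign_def D_def[symmetric] by (simp cong: map_cong)
  also have "\<dots> = prod_list (map g (concat D))"
    by (induction D) auto
  also have "\<dots> = prod g {..<length tr}"
    using prod.distinct_set_conv_list[OF D(1), of g] D(2) by simp
  also have "\<dots> = prod_list (map g [0..<length tr])"
    using prod.distinct_set_conv_list[of "[0..<length tr]" g] by (simp add: atLeast0LessThan)
  also have "map g [0..<length tr] = map (\<lambda>(a, b). edge_sign r a b) (map (\<lambda>e. tr ! e) [0..<length tr])"
    by (simp add: g_def case_prod_beta)
  finally show ?thesis by (simp only: map_nth)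
qed

lemma balanced_filter:
  assumes "mset (map fst L) = mset (map snd L)"
  shows "mset (map fst (filter (\<lambda>(p, q). p \<noteq> q) L)) = mset (map snd (filter (\<lambda>(p, q). p \<noteq> q) L))"
proof -
  have split: "mset (map g L) = mset (map g (filter (\<lambda>(p, q). p \<noteq> q) L)) + mset (map g (filter (\<lambda>(p, q). p = q) L))"
    for g :: "'a \<times> 'a \<Rightarrow> 'a"
    by (induction L) auto
  have "map fst (filter (\<lambda>(p, q). p = q) L) = map snd (filter (\<lambda>(p, q). p = q) L)"
    by (auto intro!: map_cong)
  with assms have "mset (map fst (filter (\<lambda>(p, q). p \<noteq> q) L)) + mset (map fst (filter (\<lambda>(p, q). p = q) L))
    = mset (map snd (filter (\<lambda>(p, q). p \<noteq> q) L)) + mset (map fst (filter (\<lambda>(p, q). p = q) L))"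
    by (simp only: split[of fst] split[of snd])
  then show ?thesis by (rule add_right_imp_eq)
qed

lemma balanced_projection: "mset (map fst (projection j vs)) = mset (map snd (projection j vs))"
proof -
  define L where "L = map (\<lambda>(u, v). (proj j u, proj j v)) (loop_edges vs)"
  have "map fst L = map (proj j) vs" "map snd L = map (proj j) (rotate1 vs)"
    by (auto intro!: nth_equalityI simp: L_def loop_edges_def case_prod_beta)
  then have "mset (map fst L) = mset (map snd L)" by (simp add: mset_rotate1)
  then show ?thesis unfolding projection_def L_def by (rule balanced_filter)
qed

section \<open>Orbits and the sign of a permutation\<close>

lemma orbit_of_conv_orbit: "permutation \<sigma> \<Longrightarrow> orbit_of \<sigma> v = orbit \<sigma> v"
  by (simp add: orbit_of_def orbit_altdef_permutation)

lemma orbit_of_self: "v \<in> orbit_of \<sigma> v"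
  unfolding orbit_of_def using funpow_0[of \<sigma> v] by (metis (mono_tags, lifting) mem_Collect_eq)

lemma orbit_of_eq:
  "permutation \<sigma> \<Longrightarrow> w \<in> orbit_of \<sigma> v \<Longrightarrow> orbit_of \<sigma> w = orbit_of \<sigma> v"
  using orbit_cyclic_eq3[OF cyclic_on_orbit', of \<sigma> w v] by (simp add: orbit_of_conv_orbit)

lemma orbit_of_subset: "\<sigma> permutes V \<Longrightarrow> v \<in> V \<Longrightarrow> orbit_of \<sigma> v \<subseteq> V"
  unfolding orbit_of_def using permutes_funpow[of \<sigma> V] by (auto simp: permutes_in_image)

lemma orbit_list_facts:
  assumes "permutation \<sigma>"
  shows "set (orbit_list \<sigma> v) = orbit_of \<sigma> v"
    and "distinct (orbit_list \<sigma> v)"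
    and "length (orbit_list \<sigma> v) = card (orbit_of \<sigma> v)"
    and "(\<sigma> ^^ card (orbit_of \<sigma> v)) v = v"
    and "card (orbit_of \<sigma> v) > 0"
proof -
  define N where "N = funpow_dist1 \<sigma> v v"
  have self: "v \<in> orbit \<sigma> v" using assms by (rule permutation_self_in_orbit)
  have orb: "orbit_of \<sigma> v = (\<lambda>n. (\<sigma> ^^ n) v) ` {0..<N}" 
    unfolding orbit_of_conv_orbit[OF assms] N_def by (rule orbit_conv_funpow_dist1[OF self])
  have inj: "inj_on (\<lambda>n. (\<sigma> ^^ n) v) {0..<N}"
    unfolding N_def by (rule inj_on_funpow_dist1[OF self])
  have card: "card (orbit_of \<sigma> v) = N"
    unfolding orb using card_image[OF inj] by simp
  show "(\<sigma> ^^ card (orbit_of \<sigma> v)) v = v"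
    unfolding card N_def by (rule funpow_dist1_prop[OF self])
  show "card (orbit_of \<sigma> v) > 0" unfolding card N_def by simp
  show "set (orbit_list \<sigma> v) = orbit_of \<sigma> v"
    unfolding orbit_list_def card by (simp add: orb)
  show "distinct (orbit_list \<sigma> v)"
    unfolding orbit_list_def card using inj by (simp add: distinct_map)
  show "length (orbit_list \<sigma> v) = card (orbit_of \<sigma> v)"
    by (simp add: orbit_list_def)
qed

lemma loop_edges_orbit_list:
  assumes "permutation \<sigma>"
  shows "loop_edges (orbit_list \<sigma> v) = map (\<lambda>u. (u, \<sigma> u)) (orbit_list \<sigma> v)"
proof -
  have "rotate1 (orbit_list \<sigma> v) = map \<sigma> (orbit_list \<sigma> v)"
  proof (rule nth_equalityI)
    fix k assume "k < length (rotate1 (orbit_list \<sigma> v))"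
    then have k: "k < card (orbit_of \<sigma> v)" by (simp add: orbit_list_def)
    show "rotate1 (orbit_list \<sigma> v) ! k = map \<sigma> (orbit_list \<sigma> v) ! k"
    proof (cases "Suc k = card (orbit_of \<sigma> v)")
      case True
      then have "\<sigma> ((\<sigma> ^^ k) v) = v" using orbit_list_facts(4)[OF assms, of v] by (metis comp_apply funpow.simps(2))
      then show ?thesis using k True by (simp add: nth_rotate1 orbit_list_def)
    next
      case False
      then show ?thesis using k by (simp add: nth_rotate1 orbit_list_def)
    qed
  qed simp
  then show ?thesis by (simp add: loop_edges_def zip_map2 zip_same_conv_map)
qed

lemma prod_list_orbit_list:
  "permutation \<sigma> \<Longrightarrow> prod_list (map f (orbit_list \<sigma> v)) = prod f (orbit_of \<sigma> v)"
  using prod.distinct_set_conv_list[of "orbit_list \<sigma> v" f] orbit_list_facts[of \<sigma> v] by simp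

lemma sign_cycle_of_list:
  "distinct cs \<Longrightarrow> cs \<noteq> [] \<Longrightarrow> sign (cycle_of_list cs) = (-1) ^ (length cs - 1)"
proof (induction cs rule: cycle_of_list.induct)
  case (1 i j cs)
  then show ?case
    by (simp add: sign_compose permutation_swap_id permutation_of_cycle sign_swap_id del: o_apply)
qed auto

lemma cycle_decomp_imp_permutes: "cycle_decomp I p \<Longrightarrow> finite I \<and> p permutes I"
proof (induction rule: cycle_decomp.induct)
  case empty
  then show ?case using permutes_id by blast
next
  case (comp I p cs)
  then show ?case
    using permutes_compose[of p "set cs \<union> I" "cycle_of_list cs"] cycle_permutes[of cs]
      permutes_subset[of p I "set cs \<union> I"] permutes_subset[of "cycle_of_list cs" "set cs" "set cs \<union> I"]
    by (auto simp del: o_apply simp: comp_def)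
qed

lemma sign_eq_prod_orbits:
  assumes "cycle_decomp I p"
  shows "sign p = (\<Prod>C\<in>orbit_of p ` I. (-1) ^ (card C - 1))"
  using assms
proof (induction rule: cycle_decomp.induct)
  case (comp I p cs)
  define q where "q = cycle_of_list cs \<circ> p"
  have pI: "finite I" "p permutes I" using cycle_decomp_imp_permutes[OF comp.hyps(1)] by auto
  have perm: "permutation p" "permutation (cycle_of_list cs)"
    using pI permutation_permutes permutation_of_cycle by blast+
  have on_I: "orbit_of q v = orbit_of p v" if "v \<in> I" for v
  proof -
    have "(q ^^ n) v = (p ^^ n) v \<and> (p ^^ n) v \<in> I" for n
    proof (induction n)
      case (Suc n)
      then have "p ((p ^^ n) v) \<in> I" using pI(2) by (simp add: permutes_in_image)
      moreover from this have "p ((p ^^ n) v) \<notin> set cs" using comp.hyps(3) by blast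
      ultimately show ?case using Suc by (simp add: q_def id_outside_supp)
    qed (simp add: that)
    then show ?thesis by (auto simp: orbit_of_def)
  qed
  have on_cs: "orbit_of q v = set cs" if "v \<in> set cs" for v
  proof -
    have pow: "(q ^^ n) v = (cycle_of_list cs ^^ n) v \<and> (cycle_of_list cs ^^ n) v \<in> set cs" for n
    proof (induction n)
      case (Suc n)
      then have "(cycle_of_list cs ^^ n) v \<notin> I" using comp.hyps(3) by auto
      then have "p ((cycle_of_list cs ^^ n) v) = (cycle_of_list cs ^^ n) v"
        using pI(2) by (auto simp: permutes_def)
      with Suc show ?case using cycle_permutes[of cs] by (auto simp: q_def permutes_in_image)
    qed (simp add: that)
    have "w \<in> orbit_of q v" if w: "w \<in> set cs" for w
    proof -
      obtain i j where ij: "i < length cs" "v = cs ! i" "j < length cs" "w = cs ! j"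
        using w \<open>v \<in> set cs\<close> by (metis in_set_conv_nth)
      define n where "n = (if i \<le> j then j - i else length cs + j - i)"
      have "(cycle_of_list cs ^^ n) v = map (cycle_of_list cs ^^ n) cs ! i" using ij by simp
      also have "\<dots> = cs ! ((n + i) mod length cs)"
        unfolding cyclic_rotation[OF comp.hyps(2)] using ij by (simp add: nth_rotate)
      also have "(n + i) mod length cs = j" using ij by (auto simp: n_def)
      finally have "(q ^^ n) v = w" using pow[of n] ij by simp
      then show ?thesis by (auto simp: orbit_of_def)
    qed
    moreover have "orbit_of q v \<subseteq> set cs" using pow by (auto simp: orbit_of_def)
    ultimately show ?thesis by blast
  qed
  have "orbit_of q ` I = orbit_of p ` I" using on_I by (rule image_cong[OF refl])
  moreover have "orbit_of q ` set cs = (if cs = [] then {} else {set cs})"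
    using on_cs by (cases cs) (auto simp: image_def)
  ultimately have orbits: "orbit_of q ` (set cs \<union> I) = (if cs = [] then {} else {set cs}) \<union> orbit_of p ` I"
    by (simp add: image_Un)
  have "set cs \<notin> orbit_of p ` I" if "cs \<noteq> []"
    using that comp.hyps(3) orbit_of_subset[OF pI(2)] by (cases cs) fastforce+
  then have "(\<Prod>C\<in>orbit_of q ` (set cs \<union> I). (-1) ^ (card C - 1))
    = sign (cycle_of_list cs) * (\<Prod>C\<in>orbit_of p ` I. (-1) ^ (card C - 1))"
    unfolding orbits using pI(1) comp.hyps(2)
    by (cases "cs = []") (simp_all add: sign_cycle_of_list distinct_card)
  also have "\<dots> = sign q"
    unfolding q_def comp.IH[symmetric] using perm by (simp add: sign_compose)
  finally show ?case unfolding q_def by (rule sym)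
qed simp

lemma sign_even_orbits:
  assumes "\<sigma> permutes V" "finite V" "\<And>v. v \<in> V \<Longrightarrow> \<sigma> v \<noteq> v \<Longrightarrow> even (card (orbit_of \<sigma> v))"
  shows "sign \<sigma> = (\<Prod>C\<in>{orbit_of \<sigma> v | v. v \<in> V \<and> \<sigma> v \<noteq> v}. -1)"
proof -
  have perm: "permutation \<sigma>" using assms permutation_permutes by blast
  have triv: "card (orbit_of \<sigma> v) = 1" if "\<sigma> v = v" for v
  proof -
    have "(\<sigma> ^^ n) v = v" for n by (induction n) (simp_all add: that)
    then show ?thesis by (simp add: orbit_of_def)
  qed
  have "sign \<sigma> = (\<Prod>C\<in>orbit_of \<sigma> ` V. (-1) ^ (card C - 1))"
    using cycle_decomposition[OF assms(1,2)] by (rule sign_eq_prod_orbits)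
  also have "\<dots> = (\<Prod>C\<in>{orbit_of \<sigma> v | v. v \<in> V \<and> \<sigma> v \<noteq> v}. -1)"
  proof (rule prod.mono_neutral_cong_right)
    show "\<forall>C\<in>orbit_of \<sigma> ` V - {orbit_of \<sigma> v |v. v \<in> V \<and> \<sigma> v \<noteq> v}. (-1) ^ (card C - 1) = (1::int)"
      using triv by auto
    fix C assume "C \<in> {orbit_of \<sigma> v |v. v \<in> V \<and> \<sigma> v \<noteq> v}"
    then obtain v where "C = orbit_of \<sigma> v" "v \<in> V" "\<sigma> v \<noteq> v" by blast
    then have "even (card C)" "card C > 0" using assms(3) orbit_list_facts(5)[OF perm] by auto
    then show "(-1) ^ (card C - 1) = (-1::int)" by simp
  qed (use assms(2) in auto)
  finally show ?thesis .
qed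

section \<open>The partition function as a determinant\<close>

definition tail_sign :: "nat \<Rightarrow> nat \<Rightarrow> (nat \<Rightarrow> nat) \<Rightarrow> real" where
  "tail_sign d c u = (-1) ^ (\<Sum>c'\<in>{c+1..d}. u c' + 1)"

definition grid_sign :: "nat \<Rightarrow> (nat \<Rightarrow> nat) \<Rightarrow> (nat \<Rightarrow> nat) \<Rightarrow> real" where
  "grid_sign d u v = (let c = edge_coord d u v in tail_sign d c u * (if u c < v c then 1 else -1))"

definition kasteleyn :: "nat \<Rightarrow> real \<Rightarrow> (nat \<Rightarrow> real) \<Rightarrow> (nat \<Rightarrow> nat) \<Rightarrow> (nat \<Rightarrow> nat) \<Rightarrow> real" where
  "kasteleyn d x a u v = (if u = v then x
     else if grid_adj d u v then edge_weight d a u v * grid_sign d u v else 0)"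

lemma edge_coord_eq:
  assumes "c \<in> {1..d}" "u c \<noteq> v c" "\<And>c'. c' \<in> {1..d} \<Longrightarrow> c' \<noteq> c \<Longrightarrow> u c' = v c'"
  shows "edge_coord d u v = c"
  unfolding edge_coord_def by (rule the_equality) (use assms in auto)

lemma grid_adjE:
  assumes "grid_adj d u v"
  obtains c where "c \<in> {1..d}" "edge_coord d u v = c" "edge_coord d v u = c"
    "u c = v c + 1 \<or> v c = u c + 1" "\<And>c'. c' \<in> {1..d} \<Longrightarrow> c' \<noteq> c \<Longrightarrow> u c' = v c'"
proof -
  obtain c where c: "c \<in> {1..d}" "u c = v c + 1 \<or> v c = u c + 1"
    "\<And>c'. c' \<in> {1..d} \<Longrightarrow> c' \<noteq> c \<Longrightarrow> u c' = v c'"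
    using assms unfolding grid_adj_def by auto
  then have "edge_coord d u v = c" "edge_coord d v u = c"
    by (auto intro!: edge_coord_eq)
  with c that show thesis by blast
qed

lemma grid_adj_sym: "grid_adj d u v \<Longrightarrow> grid_adj d v u"
  unfolding grid_adj_def by (metis (no_types, lifting))

lemma grid_sign_swap:
  assumes "grid_adj d u v"
  shows "grid_sign d v u = - grid_sign d u v"
  using assms
proof (rule grid_adjE)
  fix c assume c: "c \<in> {1..d}" "edge_coord d u v = c" "edge_coord d v u = c"
    "u c = v c + 1 \<or> v c = u c + 1" "\<And>c'. c' \<in> {1..d} \<Longrightarrow> c' \<noteq> c \<Longrightarrow> u c' = v c'"
  have "tail_sign d c u = tail_sign d c v"
    unfolding tail_sign_def using c(1,5) by (intro arg_cong[where f = "power (-1)"] sum.cong) auto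
  moreover have "(u c < v c) \<noteq> (v c < u c)" using c(4) by auto
  ultimately show ?thesis by (simp add: grid_sign_def Let_def c(2,3))
qed

lemma grid_sign_square: "grid_sign d u v * grid_sign d u v = 1"
  by (simp add: grid_sign_def tail_sign_def Let_def flip: power_add)

lemma edge_weight_swap:
  assumes "grid_adj d u v" shows "edge_weight d a v u = edge_weight d a u v"
  using assms by (rule grid_adjE) (simp add: edge_weight_def)

definition factor_of :: "nat \<Rightarrow> nat" where
  "factor_of c = (if c \<le> 2 then 1 else c - 1)"

definition row_shift :: "nat \<Rightarrow> nat" where
  "row_shift j = (if j = 1 then 1 else 0)"

lemma proj_eq_iff:
  assumes "1 \<le> j" "\<And>c'. c' \<in> {1..d} \<Longrightarrow> c' \<noteq> c \<Longrightarrow> u c' = v c'" "c \<in> {1..d}" "u c \<noteq> v c" "2 \<le> d" "j \<le> d - 1"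
  shows "proj j u = proj j v \<longleftrightarrow> j \<noteq> factor_of c"
proof -
  have "u c' = v c' \<longleftrightarrow> c' \<noteq> c" if "c' \<in> {1..d}" for c' using that assms by auto
  from this[of 1] this[of 2] this[of "j + 1"] assms(1,3,5,6) show ?thesis
    by (auto simp: proj_def factor_of_def)
qed

lemma sum_tail_eq_par:
  assumes "1 \<le> j" "j \<le> d - 1" "2 \<le> d"
  shows "par d u j = (\<Sum>c'\<in>{j + 2..d}. u c' + 1)"
proof -
  have "(\<Sum>c'\<in>{j + 2..d}. u c' + 1) = (\<Sum>i\<in>{j + 1..d - 1}. u (i + 1) + 1)"
    by (rule sum.reindex_bij_witness[of _ "\<lambda>i. i + 1" "\<lambda>c. c - 1"]) auto
  also have "\<dots> = par d u j"
    unfolding par_def sum.distrib using assms by simp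
  finally show ?thesis by simp
qed

text \<open>The signs of the matrix are those of the canonical orientations of the factors, twisted by the
  parities of the later coordinates; for the path factors row \<open>0\<close> is oriented to the right.\<close>
lemma grid_sign_eq_factor_sign:
  assumes d: "2 \<le> d" and adj: "grid_adj d u v"
  shows "grid_sign d u v = (\<Prod>j\<in>{1..d-1}. if proj j u \<noteq> proj j v
     then (-1) ^ par d u j * edge_sign (row_shift j) (proj j u) (proj j v) else 1)"
  using adj
proof (rule grid_adjE)
  fix c assume c: "c \<in> {1..d}" "edge_coord d u v = c" "edge_coord d v u = c"
    "u c = v c + 1 \<or> v c = u c + 1" "\<And>c'. c' \<in> {1..d} \<Longrightarrow> c' \<noteq> c \<Longrightarrow> u c' = v c'"
  define g where "g = (\<lambda>j. (-1) ^ par d u j * edge_sign (row_shift j) (proj j u) (proj j v))"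
  have neq: "u c \<noteq> v c" using c(4) by auto
  have mem: "factor_of c \<in> {1..d-1}" using c(1) d by (auto simp: factor_of_def)
  have "(\<Prod>j\<in>{1..d-1}. if proj j u \<noteq> proj j v then g j else 1) = (\<Prod>j\<in>{1..d-1}. if j = factor_of c then g j else 1)"
  proof (rule prod.cong[OF refl])
    fix j assume "j \<in> {1..d-1}"
    then have "proj j u = proj j v \<longleftrightarrow> j \<noteq> factor_of c"
      by (intro proj_eq_iff[of j d c u v]) (use c d neq in auto)
    then show "(if proj j u \<noteq> proj j v then g j else 1) = (if j = factor_of c then g j else 1)" by simp
  qed
  also have "\<dots> = g (factor_of c)" using mem by simp
  also have "\<dots> = grid_sign d u v"
  proof -
    have par: "par d u (factor_of c) = (\<Sum>c'\<in>{factor_of c + 2..d}. u c' + 1)"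
      using mem d by (intro sum_tail_eq_par) auto
    consider "c = 1" | "c = 2" | "c \<ge> 3" using c(1) by fastforce
    then show ?thesis
    proof cases
      case 1
      have "u 2 = v 2" using c(5)[of 2] 1 d by auto
      moreover have "{2..d} = insert 2 {3..d}" using d by auto
      then have "(\<Sum>c'\<in>{2..d}. u c' + 1) = u 2 + 1 + (\<Sum>c'\<in>{3..d}. u c' + 1)" by simp
      ultimately show ?thesis using 1 c(2,4) par
        by (auto simp: g_def grid_sign_def tail_sign_def factor_of_def edge_sign_def row_shift_def proj_def
            power_add numeral_2_eq_2 numeral_3_eq_3)
    next
      case 2
      then have "factor_of c = 1" by (simp add: factor_of_def)
      moreover have "u 1 = v 1" using c(5)[of 1] 2 d by auto
      then have "proj 1 u = (v 1, u c)" "proj 1 v = (v 1, v c)" by (simp_all add: proj_def 2)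
      then have "edge_sign 1 (proj 1 u) (proj 1 v) = (if u c < v c then 1 else -1)"
        using neq by (simp add: edge_sign_def)
      moreover have "tail_sign d c u = (-1) ^ par d u (factor_of c)"
        using par \<open>factor_of c = 1\<close> 2 by (simp add: tail_sign_def numeral_3_eq_3)
      ultimately show ?thesis by (simp add: g_def grid_sign_def c(2) row_shift_def)
    next
      case 3
      then have "factor_of c + 2 = c + 1" "factor_of c + 1 = c" "factor_of c \<noteq> 1" by (auto simp: factor_of_def)
      moreover from this have "proj (factor_of c) u = (u c, 0)" "proj (factor_of c) v = (v c, 0)"
        by (simp_all add: proj_def)
      then have "edge_sign 0 (proj (factor_of c) u) (proj (factor_of c) v) = (if u c < v c then 1 else -1)"
        by (simp add: edge_sign_def)
      moreover have "tail_sign d c u = (-1) ^ par d u (factor_of c)"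
        using par \<open>factor_of c + 2 = c + 1\<close> by (simp add: tail_sign_def)
      ultimately show ?thesis by (simp add: g_def grid_sign_def c(2) row_shift_def)
    qed
  qed
  finally show ?thesis unfolding g_def by (rule sym)
qed

lemma finite_grid_vertices: "finite (grid_vertices d m)"
  unfolding grid_vertices_def by (intro finite_PiE) auto

locale grid_config =
  fixes d :: nat and m :: "nat \<Rightarrow> nat" and \<sigma> :: "(nat \<Rightarrow> nat) \<Rightarrow> (nat \<Rightarrow> nat)"
  assumes d: "2 \<le> d"
    and perm: "\<sigma> permutes grid_vertices d m"
    and adj: "\<And>v. v \<in> grid_vertices d m \<Longrightarrow> \<sigma> v = v \<or> grid_adj d v (\<sigma> v)"
begin

lemma permutation: "permutation \<sigma>"
  using perm finite_grid_vertices permutation_permutes by blast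

lemma orbit_moved:
  assumes "v \<in> grid_vertices d m" "\<sigma> v \<noteq> v" "u \<in> orbit_of \<sigma> v"
  shows "u \<in> grid_vertices d m" "\<sigma> u \<noteq> u" "grid_adj d u (\<sigma> u)"
proof -
  show u: "u \<in> grid_vertices d m" using orbit_of_subset[OF perm assms(1)] assms(3) by blast
  show moved: "\<sigma> u \<noteq> u"
  proof
    assume fix_u: "\<sigma> u = u"
    have "(\<sigma> ^^ n) u = u" for n by (induction n) (simp_all add: fix_u)
    then have "orbit_of \<sigma> u = {u}" by (auto simp: orbit_of_def)
    then have "orbit_of \<sigma> v = {u}" using orbit_of_eq[OF permutation assms(3)] by simp
    then have "v = u" using orbit_of_self[of v \<sigma>] by auto
    then show False using fix_u assms(2) by simp
  qed
  show "grid_adj d u (\<sigma> u)" using adj[OF u] moved by blast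
qed

lemma even_card_orbit:
  assumes "v \<in> grid_vertices d m" "\<sigma> v \<noteq> v"
  shows "even (card (orbit_of \<sigma> v))"
proof -
  define h where "h = (\<lambda>u :: nat \<Rightarrow> nat. \<Sum>c\<in>{1..d}. u c)"
  have flip: "even (h (\<sigma> u)) \<longleftrightarrow> odd (h u)" if adj: "grid_adj d u (\<sigma> u)" for u
    using adj
  proof (rule grid_adjE)
    fix c assume c: "c \<in> {1..d}" "u c = \<sigma> u c + 1 \<or> \<sigma> u c = u c + 1"
      "\<And>c'. c' \<in> {1..d} \<Longrightarrow> c' \<noteq> c \<Longrightarrow> u c' = \<sigma> u c'"
    have "(\<Sum>c'\<in>{1..d} - {c}. u c') = (\<Sum>c'\<in>{1..d} - {c}. \<sigma> u c')"
      using c(3) by (intro sum.cong) auto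
    then show ?thesis
      using c(1,2) sum.remove[of "{1..d}" c u] sum.remove[of "{1..d}" c "\<sigma> u"] by (auto simp: h_def)
  qed
  have "even (h ((\<sigma> ^^ n) v)) \<longleftrightarrow> even (h v + n)" for n
  proof (induction n)
    case (Suc n)
    have "(\<sigma> ^^ n) v \<in> orbit_of \<sigma> v" by (auto simp: orbit_of_def)
    then show ?case using flip[OF orbit_moved(3)[OF assms]] Suc by simp
  qed simp
  from this[of "card (orbit_of \<sigma> v)"] show ?thesis
    using orbit_list_facts(4)[OF permutation, of v] by (simp, blast)
qed

lemma decomp_sign_orbit:
  assumes v: "v \<in> grid_vertices d m" "\<sigma> v \<noteq> v" and j: "j \<in> {1..d-1}"
  shows "decomp_sign (factor_vertices m j) (projection j (orbit_list \<sigma> v))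
    = (\<Prod>u\<in>orbit_of \<sigma> v. if proj j u \<noteq> proj j (\<sigma> u) then edge_sign (row_shift j) (proj j u) (proj j (\<sigma> u)) else 1)"
proof -
  define tr where "tr = projection j (orbit_list \<sigma> v)"
  have tr: "tr = filter (\<lambda>(p, q). p \<noteq> q) (map (\<lambda>u. (proj j u, proj j (\<sigma> u))) (orbit_list \<sigma> v))"
    by (simp add: tr_def projection_def loop_edges_orbit_list[OF permutation] comp_def)
  have V: "factor_vertices m j = {1..(if j = 1 then m 1 else m (j + 1))} \<times> {(if j = 1 then 1 else 0)..(if j = 1 then m 2 else 0)}"
    by (auto simp: factor_vertices_def)
  have steps: "\<forall>(p, q)\<in>set tr. unit_step p q \<and> p \<in> factor_vertices m j"
  proof safe
    fix p q assume "(p, q) \<in> set tr"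
    then obtain u where u: "u \<in> orbit_of \<sigma> v" "p = proj j u" "q = proj j (\<sigma> u)" "p \<noteq> q"
      by (auto simp: tr orbit_list_facts[OF permutation])
    have "grid_adj d u (\<sigma> u)" using orbit_moved[OF v u(1)] by blast
    then show "unit_step p q"
    proof (rule grid_adjE)
      fix c assume c: "c \<in> {1..d}" "u c = \<sigma> u c + 1 \<or> \<sigma> u c = u c + 1"
        "\<And>c'. c' \<in> {1..d} \<Longrightarrow> c' \<noteq> c \<Longrightarrow> u c' = \<sigma> u c'"
      have "j + 1 \<le> d" using j d by auto
      with c(3)[of 1] c(3)[of 2] c(3)[of "j + 1"] c(1,2) u(2-4) j d show ?thesis
        by (cases "c = 1"; cases "c = 2"; cases "c = j + 1") (auto simp: proj_def split: if_splits)
    qed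
    have "u c \<in> {1..m c}" if "c \<in> {1..d}" for c
      using orbit_moved(1)[OF v u(1)] that by (auto simp: grid_vertices_def PiE_def)
    moreover have "j + 1 \<le> d" using j d by auto
    ultimately show "p \<in> factor_vertices m j"
      using d j by (auto simp: u(2) proj_def factor_vertices_def)
  qed
  have "decomp_sign (factor_vertices m j) tr = prod_list (map (\<lambda>(a, b). edge_sign (row_shift j) a b) tr)"
    using balanced_projection steps V unfolding tr_def by (rule decomp_sign_eq_prod_edge_sign)
  also have "\<dots> = prod_list (map (\<lambda>u. if proj j u \<noteq> proj j (\<sigma> u)
      then edge_sign (row_shift j) (proj j u) (proj j (\<sigma> u)) else 1) (orbit_list \<sigma> v))"
  proof -
    have "prod_list (map (\<lambda>(a, b). edge_sign (row_shift j) a b) (filter (\<lambda>(p, q). p \<noteq> q) (map (\<lambda>u. (proj j u, proj j (\<sigma> u))) us)))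
      = prod_list (map (\<lambda>u. if proj j u \<noteq> proj j (\<sigma> u)
      then edge_sign (row_shift j) (proj j u) (proj j (\<sigma> u)) else 1) us)" for us
      by (induction us) auto
    then show ?thesis unfolding tr .
  qed
  also have "\<dots> = (\<Prod>u\<in>orbit_of \<sigma> v. if proj j u \<noteq> proj j (\<sigma> u)
      then edge_sign (row_shift j) (proj j u) (proj j (\<sigma> u)) else 1)"
    by (rule prod_list_orbit_list[OF permutation])
  finally show ?thesis unfolding tr_def .
qed

lemma e_count_orbit:
  "(-1) ^ e_count d i (orbit_list \<sigma> v)
    = (\<Prod>u\<in>orbit_of \<sigma> v. if proj i u \<noteq> proj i (\<sigma> u) then (-1) ^ par d u i else (1::real))"
proof -
  have "(-1) ^ length (filter (\<lambda>(u, v). proj i u \<noteq> proj i v \<and> odd (par d u i)) (map (\<lambda>u. (u, \<sigma> u)) us))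
    = prod_list (map (\<lambda>u. if proj i u \<noteq> proj i (\<sigma> u) then (-1) ^ par d u i else (1::real)) us)" for us
    by (induction us) auto
  then show ?thesis
    unfolding e_count_def loop_edges_orbit_list[OF permutation] prod_list_orbit_list[OF permutation, symmetric] .
qed

lemma loop_sign_orbit:
  assumes v: "v \<in> grid_vertices d m" "\<sigma> v \<noteq> v"
  shows "loop_sign d m (orbit_list \<sigma> v) = - (\<Prod>u\<in>orbit_of \<sigma> v. grid_sign d u (\<sigma> u))"
proof -
  define E where "E = (\<lambda>i u. if proj i u \<noteq> proj i (\<sigma> u) then (-1) ^ par d u i else (1::real))"
  define S where "S = (\<lambda>j u. if proj j u \<noteq> proj j (\<sigma> u) then edge_sign (row_shift j) (proj j u) (proj j (\<sigma> u)) else 1)"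
  have last: "E (d - 1) u = 1" for u by (simp add: E_def par_def)
  have ins: "{1..d-1} = insert (d - 1) {1..d-2}" using d by auto
  have E: "(\<Prod>i\<in>{1..d-2}. \<Prod>u\<in>orbit_of \<sigma> v. E i u) = (\<Prod>i\<in>{1..d-1}. \<Prod>u\<in>orbit_of \<sigma> v. E i u)"
    unfolding ins by (subst prod.insert) (use d last in auto)
  have S: "(\<Prod>j\<in>{1..d-1}. decomp_sign (factor_vertices m j) (projection j (orbit_list \<sigma> v)))
    = (\<Prod>j\<in>{1..d-1}. \<Prod>u\<in>orbit_of \<sigma> v. S j u)"
    unfolding S_def by (rule prod.cong[OF refl], rule decomp_sign_orbit[OF v])
  have "loop_sign d m (orbit_list \<sigma> v)
    = - ((\<Prod>i\<in>{1..d-2}. \<Prod>u\<in>orbit_of \<sigma> v. E i u) * (\<Prod>j\<in>{1..d-1}. \<Prod>u\<in>orbit_of \<sigma> v. S j u))"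
    unfolding loop_sign_def S E_def e_count_orbit by simp
  also have "\<dots> = - (\<Prod>j\<in>{1..d-1}. \<Prod>u\<in>orbit_of \<sigma> v. E j u * S j u)"
    unfolding E by (simp add: prod.distrib)
  also have "(\<Prod>j\<in>{1..d-1}. \<Prod>u\<in>orbit_of \<sigma> v. E j u * S j u)
     = (\<Prod>u\<in>orbit_of \<sigma> v. \<Prod>j\<in>{1..d-1}. E j u * S j u)"
    by (rule prod.swap)
  also have "\<dots> = (\<Prod>u\<in>orbit_of \<sigma> v. grid_sign d u (\<sigma> u))"
  proof (rule prod.cong[OF refl])
    fix u assume "u \<in> orbit_of \<sigma> v"
    then show "(\<Prod>j\<in>{1..d-1}. E j u * S j u) = grid_sign d u (\<sigma> u)"
      using grid_sign_eq_factor_sign[OF d orbit_moved(3)[OF v]]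
      by (auto simp: E_def S_def intro!: prod.cong)
  qed
  finally show ?thesis .
qed

lemma loop_weight_orbit:
  assumes v: "v \<in> grid_vertices d m" "\<sigma> v \<noteq> v"
  shows "loop_weight d m a (orbit_list \<sigma> v) = - (\<Prod>u\<in>orbit_of \<sigma> v. kasteleyn d x a u (\<sigma> u))"
proof -
  have K: "kasteleyn d x a u (\<sigma> u) = edge_weight d a u (\<sigma> u) * grid_sign d u (\<sigma> u)" if "u \<in> orbit_of \<sigma> v" for u
    using orbit_moved[OF v that] by (auto simp: kasteleyn_def)
  show ?thesis
  proof (cases "length (orbit_list \<sigma> v) = 2")
    case True
    then have two: "card (orbit_of \<sigma> v) = 2" by (simp add: orbit_list_facts[OF permutation])
    have ol: "orbit_list \<sigma> v = [v, \<sigma> v]" unfolding orbit_list_def two by (simp add: upt_rec)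
    have invol: "\<sigma> (\<sigma> v) = v"
      using orbit_list_facts(4)[OF permutation, of v] unfolding two by (simp add: numeral_2_eq_2)
    have adj_v: "grid_adj d v (\<sigma> v)" using orbit_moved[OF v orbit_of_self] by simp
    have "orbit_of \<sigma> v = {v, \<sigma> v}" using orbit_list_facts(1)[OF permutation, of v] ol by simp
    then have "(\<Prod>u\<in>orbit_of \<sigma> v. kasteleyn d x a u (\<sigma> u)) = kasteleyn d x a v (\<sigma> v) * kasteleyn d x a (\<sigma> v) v"
      using v(2) invol by simp
    also have "\<dots> = - (edge_weight d a v (\<sigma> v))\<^sup>2"
      using v(2) adj_v grid_adj_sym[OF adj_v] grid_sign_square[of d v "\<sigma> v"]
      by (simp add: kasteleyn_def grid_sign_swap[OF adj_v] edge_weight_swap[OF adj_v] power2_eq_square)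
    finally show ?thesis using True by (simp add: loop_weight_def ol)
  next
    case False
    have "loop_weight d m a (orbit_list \<sigma> v)
      = loop_sign d m (orbit_list \<sigma> v) * (\<Prod>u\<in>orbit_of \<sigma> v. edge_weight d a u (\<sigma> u))"
      using False by (simp add: loop_weight_def loop_edges_orbit_list[OF permutation] comp_def
          prod_list_orbit_list[OF permutation])
    also have "\<dots> = - (\<Prod>u\<in>orbit_of \<sigma> v. kasteleyn d x a u (\<sigma> u))"
      by (simp add: loop_sign_orbit[OF v] K prod.distrib cong: prod.cong)
    finally show ?thesis .
  qed
qed

lemma config_weight_eq:
  "config_weight d m x a \<sigma> = of_int (sign \<sigma>) * (\<Prod>v\<in>grid_vertices d m. kasteleyn d x a v (\<sigma> v))"
proof -
  define V where "V = grid_vertices d m"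
  define W where "W = {v\<in>V. \<sigma> v \<noteq> v}"
  define Orb where "Orb = {orbit_of \<sigma> v | v. v \<in> V \<and> \<sigma> v \<noteq> v}"
  have fin: "finite V" by (simp add: V_def finite_grid_vertices)
  have Orb_image: "Orb = orbit_of \<sigma> ` W" by (auto simp: Orb_def W_def)
  have Union: "\<Union>Orb = W"
  proof (intro equalityI subsetI)
    fix u assume "u \<in> \<Union>Orb"
    then obtain v where "v \<in> W" "u \<in> orbit_of \<sigma> v" unfolding Orb_image by blast
    then show "u \<in> W" using orbit_moved[of v u] by (simp add: W_def V_def)
  next
    fix u assume "u \<in> W"
    then show "u \<in> \<Union>Orb" unfolding Orb_image using orbit_of_self[of u \<sigma>] by blast
  qed
  have disj: "C \<inter> C' = {}" if "C \<in> Orb" "C' \<in> Orb" "C \<noteq> C'" for C C'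
    using that orbit_of_eq[OF permutation] unfolding Orb_image by blast
  have "(\<Prod>C\<in>Orb. loop_weight d m a (orbit_list \<sigma> (SOME v. v \<in> C))) = (\<Prod>C\<in>Orb. - (\<Prod>u\<in>C. kasteleyn d x a u (\<sigma> u)))"
  proof (rule prod.cong[OF refl])
    fix C assume "C \<in> Orb"
    then obtain v where v: "C = orbit_of \<sigma> v" "v \<in> V" "\<sigma> v \<noteq> v" by (auto simp: Orb_def)
    define w where "w = (SOME v. v \<in> C)"
    have "w \<in> C" unfolding w_def using orbit_of_self[of v \<sigma>] v(1) by (metis someI)
    then have "orbit_of \<sigma> w = C" "w \<in> V" "\<sigma> w \<noteq> w"
      using v orbit_of_eq[OF permutation, of w v] orbit_moved[of v w] by (auto simp: V_def)
    then show "loop_weight d m a (orbit_list \<sigma> (SOME v. v \<in> C)) = - (\<Prod>u\<in>C. kasteleyn d x a u (\<sigma> u))"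
      using loop_weight_orbit[of w a x] unfolding w_def[symmetric] by (simp add: V_def)
  qed
  also have "\<dots> = (\<Prod>C\<in>Orb. -1) * (\<Prod>C\<in>Orb. \<Prod>u\<in>C. kasteleyn d x a u (\<sigma> u))"
    by (simp only: prod.distrib[symmetric]) simp
  also have "(\<Prod>C\<in>Orb. -1) = real_of_int (sign \<sigma>)"
    unfolding Orb_def V_def using sign_even_orbits[OF perm finite_grid_vertices even_card_orbit] by simp
  also have "(\<Prod>C\<in>Orb. \<Prod>u\<in>C. kasteleyn d x a u (\<sigma> u)) = (\<Prod>u\<in>W. kasteleyn d x a u (\<sigma> u))"
    unfolding Union[symmetric] using disj fin Union
    by (intro prod.Union_disjoint[symmetric, unfolded comp_def]) (auto simp: W_def intro: finite_subset)
  finally have loops: "(\<Prod>C\<in>Orb. loop_weight d m a (orbit_list \<sigma> (SOME v. v \<in> C)))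
    = of_int (sign \<sigma>) * (\<Prod>u\<in>W. kasteleyn d x a u (\<sigma> u))" .
  have "(\<Prod>v\<in>V. kasteleyn d x a v (\<sigma> v)) = (\<Prod>v\<in>V - W. kasteleyn d x a v (\<sigma> v)) * (\<Prod>v\<in>W. kasteleyn d x a v (\<sigma> v))"
    using fin by (intro prod.subset_diff) (auto simp: W_def)
  also have "(\<Prod>v\<in>V - W. kasteleyn d x a v (\<sigma> v)) = x ^ card {v\<in>V. \<sigma> v = v}"
  proof -
    have fixed: "V - W = {v\<in>V. \<sigma> v = v}" by (auto simp: W_def)
    have "(\<Prod>v\<in>V - W. kasteleyn d x a v (\<sigma> v)) = (\<Prod>v\<in>V - W. x)"
      by (rule prod.cong) (auto simp: fixed kasteleyn_def)
    then show ?thesis by (simp add: fixed)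
  qed
  finally show ?thesis
    unfolding config_weight_def V_def[symmetric] Orb_def[symmetric] loops by simp
qed

end

theorem md_partition_function_eq_leibniz:
  assumes "2 \<le> d"
  shows "md_partition_function d m x a =
    (\<Sum>\<sigma> | \<sigma> permutes grid_vertices d m. of_int (sign \<sigma>) * (\<Prod>v\<in>grid_vertices d m. kasteleyn d x a v (\<sigma> v)))"
proof -
  define V where "V = grid_vertices d m"
  have fin: "finite V" by (simp add: V_def finite_grid_vertices)
  have conf: "grid_config d m \<sigma>" if "\<sigma> permutes V" "\<forall>v\<in>V. \<sigma> v = v \<or> grid_adj d v (\<sigma> v)" for \<sigma>
    using that assms by unfold_locales (auto simp: V_def)
  have configs: "md_configs d m = {\<sigma>. \<sigma> permutes V \<and> (\<forall>v\<in>V. \<sigma> v = v \<or> grid_adj d v (\<sigma> v))}"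
  proof -
    have "card (orbit_of \<sigma> v) = 1 \<or> even (card (orbit_of \<sigma> v))"
      if "\<sigma> permutes V" "\<forall>v\<in>V. \<sigma> v = v \<or> grid_adj d v (\<sigma> v)" "v \<in> V" for \<sigma> v
    proof (cases "\<sigma> v = v")
      case True
      then have "(\<sigma> ^^ n) v = v" for n by (induction n) simp_all
      then show ?thesis by (simp add: orbit_of_def)
    next
      case False
      then show ?thesis using grid_config.even_card_orbit[OF conf[OF that(1,2)]] that(3) by (simp add: V_def)
    qed
    then show ?thesis by (auto simp: md_configs_def V_def)
  qed
  show ?thesis
    unfolding md_partition_function_def V_def[symmetric]
  proof (rule sum.mono_neutral_cong_left)
    show "finite {\<sigma>. \<sigma> permutes V}" using fin by (rule finite_permutations)
    show "\<forall>\<sigma>\<in>{\<sigma>. \<sigma> permutes V} - md_configs d m. of_int (sign \<sigma>) * (\<Prod>v\<in>V. kasteleyn d x a v (\<sigma> v)) = 0"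
    proof
      fix \<sigma> assume "\<sigma> \<in> {\<sigma>. \<sigma> permutes V} - md_configs d m"
      then obtain v where v: "v \<in> V" "\<sigma> v \<noteq> v" "\<not> grid_adj d v (\<sigma> v)" unfolding configs by blast
      then have "kasteleyn d x a v (\<sigma> v) = 0" by (metis kasteleyn_def)
      then have "(\<Prod>v\<in>V. kasteleyn d x a v (\<sigma> v)) = 0" using v(1) by (intro prod_zero[OF fin] bexI)
      then show "of_int (sign \<sigma>) * (\<Prod>v\<in>V. kasteleyn d x a v (\<sigma> v)) = 0" by simp
    qed
  next
    fix \<sigma> assume "\<sigma> \<in> md_configs d m"
    then show "config_weight d m x a \<sigma> = of_int (sign \<sigma>) * (\<Prod>v\<in>V. kasteleyn d x a v (\<sigma> v))"
      using grid_config.config_weight_eq[OF conf] unfolding configs V_def by blast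
  qed (auto simp: configs)
qed

section \<open>Determinants over finite index sets\<close>

definition set_det :: "'i set \<Rightarrow> ('i \<Rightarrow> 'i \<Rightarrow> real) \<Rightarrow> real" where
  "set_det V M = (\<Sum>\<sigma> | \<sigma> permutes V. of_int (sign \<sigma>) * (\<Prod>v\<in>V. M v (\<sigma> v)))"

definition enum_mat :: "nat \<Rightarrow> (nat \<Rightarrow> 'i) \<Rightarrow> ('i \<Rightarrow> 'i \<Rightarrow> real) \<Rightarrow> real Matrix.mat" where
  "enum_mat n h M = Matrix.mat n n (\<lambda>(i, j). M (h i) (h j))"

lemma enum_mat_carrier [simp]: "enum_mat n h M \<in> carrier_mat n n"
  by (simp add: enum_mat_def)

lemma set_det_eq_det:
  assumes h: "bij_betw h {0..<n} V"
  shows "set_det V M = Determinant.det (enum_mat n h M)"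
proof -
  define F where "F = map_permutation {0..<n} h"
  have inj: "inj_on h {0..<n}" and img: "h ` {0..<n} = V" using h by (auto simp: bij_betw_def)
  have "F = (\<lambda>\<pi> x. if x \<in> V then h (\<pi> (inv_into {0..<n} h x)) else x)"
    by (auto simp: F_def map_permutation_def restrict_id_def img fun_eq_iff)
  then have bij: "bij_betw F {\<pi>. \<pi> permutes {0..<n}} {\<pi>. \<pi> permutes V}"
    using bij_betw_permutations[OF h] by simp
  have "set_det V M = (\<Sum>\<pi> | \<pi> permutes {0..<n}. of_int (sign (F \<pi>)) * (\<Prod>v\<in>V. M v (F \<pi> v)))"
    unfolding set_det_def by (rule sum.reindex_bij_betw[OF bij, symmetric])
  also have "\<dots> = (\<Sum>\<pi> | \<pi> permutes {0..<n}. of_int (sign \<pi>) * (\<Prod>i = 0..<n. enum_mat n h M $$ (i, \<pi> i)))"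
  proof (rule sum.cong[OF refl])
    fix \<pi> assume "\<pi> \<in> {\<pi>. \<pi> permutes {0..<n}}"
    then have p: "\<pi> permutes {0..<n}" by simp
    have "sign (F \<pi>) = sign \<pi>" unfolding F_def by (rule sign_map_permutation[OF inj p]) simp
    moreover have "(\<Prod>v\<in>V. M v (F \<pi> v)) = (\<Prod>i = 0..<n. M (h i) (F \<pi> (h i)))"
      by (rule prod.reindex_bij_betw[OF h, symmetric])
    moreover have "\<dots> = (\<Prod>i = 0..<n. enum_mat n h M $$ (i, \<pi> i))"
    proof (rule prod.cong[OF refl])
      fix i assume i: "i \<in> {0..<n}"
      then have "\<pi> i \<in> {0..<n}" using p by (simp only: permutes_in_image)
      then show "M (h i) (F \<pi> (h i)) = enum_mat n h M $$ (i, \<pi> i)"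
        using i by (simp add: F_def map_permutation_apply[OF inj] enum_mat_def)
    qed
    ultimately show "of_int (sign (F \<pi>)) * (\<Prod>v\<in>V. M v (F \<pi> v))
      = of_int (sign \<pi>) * (\<Prod>i = 0..<n. enum_mat n h M $$ (i, \<pi> i))" by simp
  qed
  also have "\<dots> = Determinant.det (enum_mat n h M)"
    by (simp add: Determinant.det_def enum_mat_def)
  finally show ?thesis .
qed

lemma set_det_cong:
  assumes "\<And>u v. u \<in> V \<Longrightarrow> v \<in> V \<Longrightarrow> M u v = N u v"
  shows "set_det V M = set_det V N"
  unfolding set_det_def
proof (rule sum.cong[OF refl])
  fix \<sigma> assume "\<sigma> \<in> {\<sigma>. \<sigma> permutes V}"
  then have "(\<Prod>v\<in>V. M v (\<sigma> v)) = (\<Prod>v\<in>V. N v (\<sigma> v))"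
    using assms by (intro prod.cong) (auto simp: permutes_in_image)
  then show "of_int (sign \<sigma>) * (\<Prod>v\<in>V. M v (\<sigma> v)) = of_int (sign \<sigma>) * (\<Prod>v\<in>V. N v (\<sigma> v))" by simp
qed

lemma set_det_mult:
  assumes "finite V"
  shows "set_det V (\<lambda>u w. \<Sum>v\<in>V. M u v * N v w) = set_det V M * set_det V N"
proof -
  obtain h where h: "bij_betw h {0..<card V} V" using ex_bij_betw_nat_finite[OF assms] by blast
  have "enum_mat (card V) h (\<lambda>u w. \<Sum>v\<in>V. M u v * N v w) = enum_mat (card V) h M * enum_mat (card V) h N"
  proof (rule eq_matI)
    fix i j assume "i < dim_row (enum_mat (card V) h M * enum_mat (card V) h N)"
      "j < dim_col (enum_mat (card V) h M * enum_mat (card V) h N)"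
    then have "i < card V" "j < card V" by (simp_all add: enum_mat_def)
    then show "enum_mat (card V) h (\<lambda>u w. \<Sum>v\<in>V. M u v * N v w) $$ (i, j)
       = (enum_mat (card V) h M * enum_mat (card V) h N) $$ (i, j)"
      by (simp add: enum_mat_def scalar_prod_def sum.reindex_bij_betw[OF h, symmetric])
  qed (simp_all add: enum_mat_def)
  then show ?thesis
    by (simp add: set_det_eq_det[OF h] Determinant.det_mult[of _ "card V"])
qed

lemma set_det_transpose:
  assumes "finite V"
  shows "set_det V (\<lambda>u v. M v u) = set_det V M"
proof -
  obtain h where h: "bij_betw h {0..<card V} V" using ex_bij_betw_nat_finite[OF assms] by blast
  have "enum_mat (card V) h (\<lambda>u v. M v u) = transpose_mat (enum_mat (card V) h M)"
    by (rule eq_matI) (auto simp: enum_mat_def)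
  then show ?thesis
    by (simp add: set_det_eq_det[OF h] Determinant.det_transpose[of _ "card V"])
qed

lemma set_det_diagonal:
  assumes "finite V"
  shows "set_det V (\<lambda>u v. if u = v then f u else 0) = (\<Prod>v\<in>V. f v)"
proof -
  have zero: "(\<Prod>v\<in>V. if v = \<sigma> v then f v else 0) = 0" if perm: "\<sigma> permutes V" and ne: "\<sigma> \<noteq> id" for \<sigma>
  proof -
    obtain v where "\<sigma> v \<noteq> v" using ne by (auto simp: fun_eq_iff)
    moreover from this have "v \<in> V" using perm by (metis permutes_not_in)
    ultimately show ?thesis by (intro prod_zero[OF assms] bexI[of _ v]) auto
  qed
  have "set_det V (\<lambda>u v. if u = v then f u else 0)
    = (\<Sum>\<sigma>\<in>{id}. of_int (sign \<sigma>) * (\<Prod>v\<in>V. if v = \<sigma> v then f v else 0))"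
    unfolding set_det_def
    by (rule sum.mono_neutral_right) (use assms zero permutes_id in \<open>auto simp: finite_permutations\<close>)
  then show ?thesis by simp
qed

lemma set_det_monic_poly:
  assumes "finite V"
  shows "\<exists>p. lead_coeff p = 1 \<and> (\<forall>x. set_det V (\<lambda>u v. (if u = v then x else 0) + N u v) = poly p x)"
proof -
  obtain h where h: "bij_betw h {0..<card V} V" using ex_bij_betw_nat_finite[OF assms] by blast
  define A where "A = enum_mat (card V) h (\<lambda>u v. - N u v)"
  have A: "A \<in> carrier_mat (card V) (card V)" by (simp add: A_def)
  have "set_det V (\<lambda>u v. (if u = v then x else 0) + N u v) = poly (char_poly A) x" for x
  proof -
    have "enum_mat (card V) h (\<lambda>u v. (if u = v then x else 0) + N u v) = - (char_matrix A x)"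
    proof (rule eq_matI)
      fix i j assume "i < dim_row (- (char_matrix A x))" "j < dim_col (- (char_matrix A x))"
      then have ij: "i < card V" "j < card V" by (simp_all add: char_matrix_def A_def enum_mat_def)
      then have "h i = h j \<longleftrightarrow> i = j" using h by (auto simp: bij_betw_def inj_on_def)
      then show "enum_mat (card V) h (\<lambda>u v. (if u = v then x else 0) + N u v) $$ (i, j) = (- (char_matrix A x)) $$ (i, j)"
        using ij by (auto simp: char_matrix_def A_def enum_mat_def)
    qed (simp_all add: char_matrix_def A_def enum_mat_def)
    then show ?thesis
      by (simp add: set_det_eq_det[OF h] char_poly_matrix[OF A])
  qed
  moreover have "lead_coeff (char_poly A) = 1" using degree_monic_char_poly[OF A] by simp
  ultimately show ?thesis by blast
qed

lemma monic_poly_eqI: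
  fixes p q :: "real poly"
  assumes "lead_coeff p = 1" "lead_coeff q = 1" "\<And>x. (poly p x)\<^sup>2 = (poly q x)\<^sup>2"
  shows "p = q"
proof -
  have "poly (p * p) = poly (q * q)" using assms(3) by (auto simp: power2_eq_square)
  then have "p * p = q * q" by (simp only: poly_eq_poly_eq_iff)
  then have "(p - q) * (p + q) = 0" by (simp add: algebra_simps)
  then consider "p = q" | "p = - q" by (auto simp: eq_neg_iff_add_eq_0)
  then show ?thesis
  proof cases
    case 2
    then have "lead_coeff p = - lead_coeff q" by simp
    then show ?thesis using assms by simp
  qed
qed

text \<open>Reflecting each index \<open>k \<mapsto> m + 1 - k\<close>: \<open>S\<close> collects the coordinates that sit at the fixed point.\<close>
lemma prod_PiE_fold:
  fixes t :: "'c \<Rightarrow> nat \<Rightarrow> real"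
  assumes "finite I" "\<And>c k. c \<in> I \<Longrightarrow> k \<in> {1..m c} \<Longrightarrow> t c (m c + 1 - k) = t c k"
    and "\<And>c. c \<in> I \<Longrightarrow> odd (m c) \<Longrightarrow> t c ((m c + 1) div 2) = 0"
  shows "(\<Prod>i\<in>PiE I (\<lambda>c. {1..m c}). y + (\<Sum>c\<in>I. t c (i c)))
    = (\<Prod>S\<in>Pow {c\<in>I. odd (m c)}. (\<Prod>i\<in>PiE (I - S) (\<lambda>c. {1..m c div 2}). y + (\<Sum>c\<in>I - S. t c (i c)))
        ^ 2 ^ (card I - card S))"
  using assms
proof (induction I arbitrary: y rule: finite_induct)
  case (insert b I)
  define H where "H = (\<lambda>y. \<Prod>i\<in>PiE I (\<lambda>c. {1..m c}). y + (\<Sum>c\<in>I. t c (i c)))"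
  define G where "G = (\<lambda>J y. \<Prod>i\<in>PiE J (\<lambda>c. {1..m c div 2}). y + (\<Sum>c\<in>J. t c (i c)))"
  define Od where "Od = {c\<in>I. odd (m c)}"
  have fin: "finite Od" using insert.hyps by (simp add: Od_def)
  have split_PiE: "(\<Prod>i\<in>PiE (insert b J) B. y + (\<Sum>c\<in>insert b J. t c (i c)))
    = (\<Prod>k\<in>B b. \<Prod>i\<in>PiE J B. (y + t b k) + (\<Sum>c\<in>J. t c (i c)))"
    if "J \<subseteq> I" for J and B :: "'c \<Rightarrow> nat set" and y
  proof -
    have bJ: "b \<notin> J" "finite J" using that insert.hyps finite_subset by auto
    have inj: "inj_on (\<lambda>(k, i). i(b := k)) (B b \<times> PiE J B)"
      by (rule inj_combinator[OF bJ(1)])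
    have "(\<Prod>i\<in>PiE (insert b J) B. y + (\<Sum>c\<in>insert b J. t c (i c)))
      = (\<Prod>(k, i)\<in>B b \<times> PiE J B. y + (\<Sum>c\<in>insert b J. t c ((i(b := k)) c)))"
      unfolding PiE_insert_eq using inj by (subst prod.reindex) (auto simp: case_prod_beta)
    also have "\<dots> = (\<Prod>(k, i)\<in>B b \<times> PiE J B. (y + t b k) + (\<Sum>c\<in>J. t c (i c)))"
    proof (rule prod.cong[OF refl], safe)
      fix k i
      have "(\<Sum>c\<in>J. t c ((i(b := k)) c)) = (\<Sum>c\<in>J. t c (i c))" using bJ by (intro sum.cong) auto
      then show "y + (\<Sum>c\<in>insert b J. t c ((i(b := k)) c)) = (y + t b k) + (\<Sum>c\<in>J. t c (i c))"
        using bJ by simp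
    qed
    finally show ?thesis by (simp add: prod.cartesian_product)
  qed
  have IH: "H y = (\<Prod>S\<in>Pow Od. G (I - S) y ^ 2 ^ (card I - card S))" for y
    unfolding H_def G_def Od_def using insert by (intro insert.IH) auto
  have fold: "(\<Prod>k\<in>{1..m b}. H (y + t b k)) = (\<Prod>k\<in>{1..m b div 2}. H (y + t b k)) ^ 2 * (if odd (m b) then H y else 1)"
  proof -
    define n where "n = m b div 2"
    have refl: "(\<Prod>k\<in>{m b + 1 - n..m b}. H (y + t b k)) = (\<Prod>k\<in>{1..n}. H (y + t b k))"
    proof (rule prod.reindex_bij_witness[of _ "\<lambda>k. m b + 1 - k" "\<lambda>k. m b + 1 - k"])
      fix k assume k: "k \<in> {m b + 1 - n..m b}"
      then show "H (y + t b (m b + 1 - k)) = H (y + t b k)"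
        using insert.prems(1)[of b k] by (auto simp: n_def)
    qed (auto simp: n_def)
    show ?thesis
    proof (cases "odd (m b)")
      case True
      then have m: "m b = 2 * n + 1" by (simp add: n_def)
      then have "{1..m b} = {1..n} \<union> insert (n + 1) {m b + 1 - n..m b}" by auto
      then have "(\<Prod>k\<in>{1..m b}. H (y + t b k)) = (\<Prod>k\<in>{1..n}. H (y + t b k)) * (\<Prod>k\<in>insert (n + 1) {m b + 1 - n..m b}. H (y + t b k))"
        using m by (simp only:) (intro prod.union_disjoint, auto)
      moreover have "(\<Prod>k\<in>insert (n + 1) {m b + 1 - n..m b}. H (y + t b k)) = H (y + t b (n + 1)) * (\<Prod>k\<in>{m b + 1 - n..m b}. H (y + t b k))"
        using m by (intro prod.insert) auto
      moreover have "t b (n + 1) = 0" using insert.prems(2)[of b] True m by simp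
      ultimately show ?thesis using True refl by (simp add: power2_eq_square n_def)
    next
      case False
      then have m: "m b = 2 * n" by (simp add: n_def)
      then have "{1..m b} = {1..n} \<union> {m b + 1 - n..m b}" by auto
      then have "(\<Prod>k\<in>{1..m b}. H (y + t b k)) = (\<Prod>k\<in>{1..n}. H (y + t b k)) * (\<Prod>k\<in>{m b + 1 - n..m b}. H (y + t b k))"
        using m by (simp only:) (intro prod.union_disjoint, auto)
      then show ?thesis using False refl by (simp add: power2_eq_square n_def)
    qed
  qed
  have half: "(\<Prod>k\<in>{1..m b div 2}. H (y + t b k)) ^ 2
    = (\<Prod>S\<in>Pow Od. G (insert b I - S) y ^ 2 ^ (card (insert b I) - card S))"
  proof -
    have "(\<Prod>k\<in>{1..m b div 2}. H (y + t b k)) ^ 2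
      = (\<Prod>S\<in>Pow Od. (\<Prod>k\<in>{1..m b div 2}. G (I - S) (y + t b k)) ^ 2 ^ (Suc (card I - card S)))"
      unfolding IH by (subst prod.swap) (simp add: prod_power_distrib power_mult[symmetric] mult.commute)
    also have "\<dots> = (\<Prod>S\<in>Pow Od. G (insert b I - S) y ^ 2 ^ (card (insert b I) - card S))"
    proof (rule prod.cong[OF refl])
      fix S assume "S \<in> Pow Od"
      then have S: "S \<subseteq> I" "b \<notin> S" using insert.hyps by (auto simp: Od_def)
      then have "card S \<le> card I" using insert.hyps by (intro card_mono)
      then have "Suc (card I - card S) = card (insert b I) - card S" using insert.hyps by simp
      moreover have "insert b I - S = insert b (I - S)" using S by auto
      then have "G (insert b I - S) y = (\<Prod>k\<in>{1..m b div 2}. G (I - S) (y + t b k))"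
        unfolding G_def by (simp only: split_PiE[of "I - S", OF Diff_subset])
      ultimately show "(\<Prod>k\<in>{1..m b div 2}. G (I - S) (y + t b k)) ^ 2 ^ (Suc (card I - card S))
        = G (insert b I - S) y ^ 2 ^ (card (insert b I) - card S)" by simp
    qed
    finally show ?thesis .
  qed
  have mid: "H y = (\<Prod>S\<in>Pow Od. G (insert b I - insert b S) y ^ 2 ^ (card (insert b I) - card (insert b S)))"
    unfolding IH
  proof (rule prod.cong[OF refl])
    fix S assume "S \<in> Pow Od"
    then have "S \<subseteq> I" "b \<notin> S" "finite S" using insert.hyps fin by (auto simp: Od_def intro: finite_subset)
    then have "insert b I - insert b S = I - S" "card (insert b I) - card (insert b S) = card I - card S"
      using insert.hyps by auto
    then show "G (I - S) y ^ 2 ^ (card I - card S)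
      = G (insert b I - insert b S) y ^ 2 ^ (card (insert b I) - card (insert b S))" by simp
  qed
  have "(\<Prod>i\<in>PiE (insert b I) (\<lambda>c. {1..m c}). y + (\<Sum>c\<in>insert b I. t c (i c))) = (\<Prod>k\<in>{1..m b}. H (y + t b k))"
    unfolding H_def by (rule split_PiE) simp
  also have "\<dots> = (\<Prod>S\<in>Pow {c\<in>insert b I. odd (m c)}. G (insert b I - S) y ^ 2 ^ (card (insert b I) - card S))"
  proof (cases "odd (m b)")
    case True
    then have "{c\<in>insert b I. odd (m c)} = insert b Od" by (auto simp: Od_def)
    moreover have "(\<Prod>S\<in>Pow (insert b Od). f S) = (\<Prod>S\<in>Pow Od. f S) * (\<Prod>S\<in>Pow Od. f (insert b S))" for f :: "'c set \<Rightarrow> real"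
    proof -
      have b: "b \<notin> Od" using insert.hyps by (simp add: Od_def)
      then have "(\<Prod>S\<in>Pow (insert b Od). f S) = (\<Prod>S\<in>Pow Od. f S) * (\<Prod>S\<in>insert b ` Pow Od. f S)"
        unfolding Pow_insert using fin by (intro prod.union_disjoint) auto
      moreover have "inj_on (insert b) (Pow Od)" using b by (auto simp: inj_on_def)
      ultimately show ?thesis by (simp add: prod.reindex)
    qed
    ultimately show ?thesis unfolding fold half using True mid by simp
  next
    case False
    then have "{c\<in>insert b I. odd (m c)} = Od" by (auto simp: Od_def)
    then show ?thesis unfolding fold half using False by simp
  qed
  finally show ?case by (simp add: G_def)
qed simp

section \<open>The spectrum of the Kasteleyn matrix\<close>

definition osc :: "nat \<Rightarrow> nat \<Rightarrow> nat \<Rightarrow> real" where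
  "osc n i k = (-1) ^ (k div 2) * sin (real k * (real i * pi / real (n + 1)))"

lemma osc_zero [simp]: "osc n i 0 = 0"
  by (simp add: osc_def)

lemma osc_end [simp]: "osc n i (n + 1) = 0"
proof -
  have "real (n + 1) * (real i * pi / real (n + 1)) = real i * pi" by (simp add: field_simps)
  then show ?thesis unfolding osc_def by simp
qed

lemma osc_step:
  assumes "1 \<le> k"
  shows "osc n i (k + 1) - osc n i (k - 1) = 2 * cos (real i * pi / real (n + 1)) * (-1) ^ k * osc n i k"
proof -
  define t where "t = real i * pi / real (n + 1)"
  obtain j where k: "k = Suc j" using assms by (cases k) auto
  have sgn1: "(-1::real) ^ ((k + 1) div 2) = - ((-1) ^ ((k - 1) div 2))" by (simp add: k)
  have sgn2: "(-1::real) ^ ((k + 1) div 2) = (-1) ^ k * (-1) ^ (k div 2)"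
  proof (cases "even k")
    case True
    then show ?thesis by (auto elim!: evenE)
  next
    case False
    then show ?thesis by (auto elim!: oddE)
  qed
  have "osc n i (k + 1) - osc n i (k - 1)
    = (-1) ^ ((k + 1) div 2) * (sin (real (k + 1) * t) + sin (real (k - 1) * t))"
    unfolding osc_def t_def[symmetric] sgn1 by (simp add: algebra_simps)
  also have "sin (real (k + 1) * t) + sin (real (k - 1) * t) = 2 * sin (real k * t) * cos t"
  proof -
    have "real (k + 1) * t = real k * t + t" "real (k - 1) * t = real k * t - t"
      by (simp_all add: k algebra_simps)
    then show ?thesis by (simp only: sin_add sin_diff)
  qed
  also have "(-1) ^ ((k + 1) div 2) * (2 * sin (real k * t) * cos t)
    = 2 * cos t * (-1) ^ k * osc n i k"
    unfolding osc_def t_def[symmetric] sgn2 by simp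
  finally show ?thesis unfolding t_def .
qed

lemma sum_cos_multiples:
  assumes "0 < n" "n < 2 * (N + 1)"
  shows "(\<Sum>k\<le>N. cos (real k * (real n * pi / real (N + 1)))) = (if even n then 0 else 1)"
proof -
  define x where "x = real n * pi / real (N + 1)"
  have dirichlet: "2 * sin (x / 2) * (\<Sum>k\<le>M. cos (real k * x)) = sin (real (M + 1) * x - x / 2) + sin (x / 2)" for M
  proof (induction M)
    case 0
    then show ?case using sin_diff[of x "x / 2"] sin_add[of "x/2" "x/2"] by simp
  next
    case (Suc M)
    have "2 * sin (x / 2) * cos (real (Suc M) * x) = sin (real (Suc M + 1) * x - x / 2) - sin (real (M + 1) * x - x / 2)"
    proof -
      have "real (Suc M + 1) * x - x / 2 = real (Suc M) * x + x / 2"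
        "real (M + 1) * x - x / 2 = real (Suc M) * x - x / 2"
        by (simp_all add: algebra_simps)
      then show ?thesis by (simp only: sin_add sin_diff) (simp add: algebra_simps)
    qed
    then show ?case using Suc by (simp add: algebra_simps)
  qed
  have "real (N + 1) * x = real n * pi" by (simp add: x_def field_simps)
  moreover have "sin (real n * pi - x / 2) = (if even n then - 1 else 1) * sin (x / 2)"
    by (simp add: sin_diff)
  ultimately have "2 * sin (x / 2) * (\<Sum>k\<le>N. cos (real k * x)) = (if even n then 0 else 2 * sin (x / 2))"
    using dirichlet[of N] by simp
  moreover have "sin (x / 2) > 0"
  proof (rule sin_gt_zero)
    show "0 < x / 2" using assms(1) by (simp add: x_def)
    have "real n < 2 * real (N + 1)" using assms(2) by linarith
    then have "real n / (2 * real (N + 1)) * pi < 1 * pi" by (intro mult_strict_right_mono) auto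
    then show "x / 2 < pi" by (simp add: x_def mult.commute)
  qed
  ultimately show ?thesis by (simp add: x_def split: if_splits)
qed

lemma osc_orthogonal:
  assumes "i \<in> {1..n}" "j \<in> {1..n}"
  shows "(\<Sum>k\<in>{1..n}. osc n i k * osc n j k) = (if i = j then real (n + 1) / 2 else 0)"
  using assms
proof (induction i j rule: linorder_wlog)
  case (le j i)
  define \<theta> where "\<theta> = (\<lambda>q. real q * pi / real (n + 1))"
  have "(\<Sum>k\<in>{1..n}. osc n j k * osc n i k) = (\<Sum>k\<in>{1..n}. sin (real k * \<theta> j) * sin (real k * \<theta> i))"
    by (rule sum.cong) (simp_all add: osc_def \<theta>_def flip: power_add mult_2 power_mult_distrib)
  also have "\<dots> = (\<Sum>k\<le>n. sin (real k * \<theta> j) * sin (real k * \<theta> i))"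
    by (rule sum.mono_neutral_left) (auto simp: not_le)
  also have "\<dots> = (\<Sum>k\<le>n. (cos (real k * \<theta> (i - j)) - cos (real k * \<theta> (i + j))) / 2)"
  proof (rule sum.cong[OF refl])
    fix k
    have "real k * \<theta> (i - j) = real k * \<theta> i - real k * \<theta> j" "real k * \<theta> (i + j) = real k * \<theta> i + real k * \<theta> j"
    proof -
      have "\<theta> (i - j) = \<theta> i - \<theta> j" "\<theta> (i + j) = \<theta> i + \<theta> j"
        using le by (simp_all add: \<theta>_def of_nat_diff left_diff_distrib distrib_right diff_divide_distrib add_divide_distrib)
      then show "real k * \<theta> (i - j) = real k * \<theta> i - real k * \<theta> j" "real k * \<theta> (i + j) = real k * \<theta> i + real k * \<theta> j"
        by (simp_all add: right_diff_distrib distrib_left)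
    qed
    then show "sin (real k * \<theta> j) * sin (real k * \<theta> i) = (cos (real k * \<theta> (i - j)) - cos (real k * \<theta> (i + j))) / 2"
      by (simp add: cos_diff cos_add)
  qed
  also have "\<dots> = ((\<Sum>k\<le>n. cos (real k * \<theta> (i - j))) - (\<Sum>k\<le>n. cos (real k * \<theta> (i + j)))) / 2"
    by (simp add: sum_subtractf sum_divide_distrib diff_divide_distrib)
  finally have sum: "(\<Sum>k\<in>{1..n}. osc n j k * osc n i k)
    = ((\<Sum>k\<le>n. cos (real k * \<theta> (i - j))) - (\<Sum>k\<le>n. cos (real k * \<theta> (i + j)))) / 2" .
  show ?case
  proof (cases "i = j")
    case True
    then show ?thesis using sum sum_cos_multiples[of "i + j" n] le by (simp add: \<theta>_def)
  next
    case False
    then have "(\<Sum>k\<le>n. cos (real k * \<theta> (i - j))) = (\<Sum>k\<le>n. cos (real k * \<theta> (i + j)))"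
      using sum_cos_multiples[of "i - j" n] sum_cos_multiples[of "i + j" n] le by (simp add: \<theta>_def)
    then show ?thesis using sum False by simp
  qed
next
  case (sym i j)
  then show ?case by (cases "i = j") (auto simp: mult.commute)
qed

lemma kasteleyn_split: "kasteleyn d x a u v = (if u = v then x else 0) + kasteleyn d 0 a u v"
  by (simp add: kasteleyn_def)

lemma kasteleyn_antisym: "kasteleyn d 0 a v u = - kasteleyn d 0 a u v"
proof (cases "grid_adj d u v")
  case True
  then have "grid_adj d v u" by (rule grid_adj_sym)
  with True show ?thesis
    by (simp add: kasteleyn_def grid_sign_swap[OF True] edge_weight_swap[OF True])
next
  case False
  then have "\<not> grid_adj d v u" using grid_adj_sym by blast
  with False show ?thesis by (simp add: kasteleyn_def)
qed

lemma kasteleyn_update: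
  assumes c: "c \<in> {1..d}" and pos: "1 \<le> u c" and v: "v = u(c := if b then u c + 1 else u c - 1)"
  shows "kasteleyn d 0 a u v = a c * tail_sign d c u * (if b then 1 else - 1)"
proof -
  have neq: "u c \<noteq> v c" and same: "\<And>c'. c' \<noteq> c \<Longrightarrow> u c' = v c'" using pos v by auto
  have "u c = v c + 1 \<or> v c = u c + 1" using pos v by auto
  then have "grid_adj d u v" using c same unfolding grid_adj_def by blast
  moreover have "edge_coord d u v = c" using c neq same by (intro edge_coord_eq)
  moreover have "u c < v c \<longleftrightarrow> b" using pos v by auto
  moreover have "u \<noteq> v" using neq by auto
  ultimately show ?thesis by (simp add: kasteleyn_def edge_weight_def grid_sign_def Let_def)
qed

lemma kasteleyn_apply:
  assumes u: "u \<in> grid_vertices d m"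
    and F: "\<And>c. c \<in> {1..d} \<Longrightarrow> F (u(c := 0)) = 0" "\<And>c. c \<in> {1..d} \<Longrightarrow> F (u(c := m c + 1)) = 0"
  shows "(\<Sum>v\<in>grid_vertices d m. kasteleyn d 0 a u v * F v)
    = (\<Sum>c\<in>{1..d}. a c * tail_sign d c u * (F (u(c := u c + 1)) - F (u(c := u c - 1))))"
proof -
  define V where "V = grid_vertices d m"
  define nbr where "nbr = (\<lambda>(c, b). u(c := if b then u c + 1 else u c - 1))"
  define I :: "(nat \<times> bool) set" where "I = {1..d} \<times> UNIV"
  define g where "g = (\<lambda>v. kasteleyn d 0 a u v * F v)"
  have range: "1 \<le> u c" "u c \<le> m c" if "c \<in> {1..d}" for c
    using u that by (auto simp: grid_vertices_def PiE_def Pi_def)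
  have inj: "inj_on nbr I"
  proof (rule inj_onI)
    fix p p' assume pp: "p \<in> I" "p' \<in> I" "nbr p = nbr p'"
    obtain c b c' b' where eq: "p = (c, b)" "p' = (c', b')" by (cases p, cases p')
    have c: "1 \<le> u c" using pp(1) range eq by (auto simp: I_def)
    have "nbr p c = nbr p' c" using pp(3) by simp
    then have "c = c' \<and> b = b'" using c unfolding eq nbr_def by (auto split: if_splits)
    then show "p = p'" by (simp add: eq)
  qed
  have nbr_in: "v \<in> nbr ` I" if "v \<in> V" "g v \<noteq> 0" for v
  proof -
    have "grid_adj d u v" using that(2) by (auto simp: g_def kasteleyn_def split: if_splits)
    then show ?thesis
    proof (rule grid_adjE)
      fix c assume c: "c \<in> {1..d}" "u c = v c + 1 \<or> v c = u c + 1"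
        "\<And>c'. c' \<in> {1..d} \<Longrightarrow> c' \<noteq> c \<Longrightarrow> u c' = v c'"
      have "u c' = v c'" if "c' \<noteq> c" for c'
        using c(3)[of c'] that u \<open>v \<in> V\<close> by (cases "c' \<in> {1..d}") (auto simp: V_def grid_vertices_def PiE_def extensional_def)
      then have "v = nbr (c, v c = u c + 1)" using c(2) by (auto simp: nbr_def fun_eq_iff)
      then show ?thesis using c(1) by (auto simp: I_def)
    qed
  qed
  have nbr_out: "g v = 0" if v: "v \<in> nbr ` I" "v \<notin> V" for v
  proof -
    obtain c b where cb: "c \<in> {1..d}" "v = u(c := if b then u c + 1 else u c - 1)"
      using v(1) by (auto simp: nbr_def I_def)
    have "v c \<notin> {1..m c}"
    proof
      assume "v c \<in> {1..m c}"
      then have "v \<in> V" using u cb by (auto simp: V_def grid_vertices_def PiE_def Pi_def extensional_def)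
      then show False using v(2) by simp
    qed
    then have "v = u(c := 0) \<or> v = u(c := m c + 1)" using range[OF cb(1)] cb(2) by (auto split: if_splits)
    then show ?thesis using F[OF cb(1)] by (auto simp: g_def)
  qed
  have fin: "finite V" "finite I" by (simp_all add: V_def I_def finite_grid_vertices)
  have "sum g V = sum g (V \<union> nbr ` I)"
    using nbr_out fin by (intro sum.mono_neutral_left) auto
  also have "\<dots> = sum g (nbr ` I)"
    using nbr_in fin by (intro sum.mono_neutral_right) auto
  also have "\<dots> = (\<Sum>c\<in>{1..d}. \<Sum>b\<in>UNIV. g (nbr (c, b)))"
    unfolding sum.reindex[OF inj] by (simp add: I_def sum.cartesian_product comp_def)
  also have "\<dots> = (\<Sum>c\<in>{1..d}. a c * tail_sign d c u * (F (u(c := u c + 1)) - F (u(c := u c - 1))))"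
  proof (rule sum.cong[OF refl])
    fix c assume c: "c \<in> {1..d}"
    have "g (nbr (c, b)) = a c * tail_sign d c u * (if b then 1 else - 1) * F (nbr (c, b))" for b
      using kasteleyn_update[of c d u "nbr (c, b)" b a] c range(1)[OF c] by (simp add: g_def nbr_def)
    then show "(\<Sum>b\<in>UNIV. g (nbr (c, b))) = a c * tail_sign d c u * (F (u(c := u c + 1)) - F (u(c := u c - 1)))"
      by (simp add: UNIV_bool nbr_def algebra_simps)
  qed
  finally show ?thesis by (simp add: g_def V_def)
qed

lemma tail_sign_eq_prod: "tail_sign d b u = (\<Prod>c\<in>{b+1..d}. (-1) ^ (u c + 1))"
  unfolding tail_sign_def by (rule power_sum)

lemma tail_sign_square: "tail_sign d b u * tail_sign d b u = 1"
  by (simp add: tail_sign_def flip: power_add)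

lemma tail_sign_update:
  assumes "c \<in> {1..d}" "odd (k + u c)"
  shows "tail_sign d b (u(c := k)) = (if b < c then -1 else 1) * tail_sign d b u"
proof (cases "b < c")
  case True
  then have c: "c \<in> {b+1..d}" using assms(1) by auto
  have "(\<Prod>c'\<in>{b+1..d} - {c}. (-1::real) ^ ((u(c := k)) c' + 1)) = (\<Prod>c'\<in>{b+1..d} - {c}. (-1) ^ (u c' + 1))"
    by (rule prod.cong) auto
  moreover have "(-1::real) ^ (k + 1) = - ((-1) ^ (u c + 1))"
    using assms(2) by (cases "even k") auto
  ultimately show ?thesis
    using True prod.remove[OF _ c, of "\<lambda>c'. (-1::real) ^ ((u(c := k)) c' + 1)"]
      prod.remove[OF _ c, of "\<lambda>c'. (-1::real) ^ (u c' + 1)"]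
    by (simp add: tail_sign_eq_prod)
next
  case False
  then show ?thesis by (auto simp: tail_sign_eq_prod intro!: prod.cong)
qed

lemma tail_sign_pred:
  assumes "c \<in> {1..d}"
  shows "tail_sign d (c - 1) u = (-1) ^ (u c + 1) * tail_sign d c u"
proof -
  have "{c - 1 + 1..d} = insert c {c + 1..d}" using assms by auto
  then show ?thesis unfolding tail_sign_eq_prod by simp
qed

definition osc_basis :: "nat \<Rightarrow> (nat \<Rightarrow> nat) \<Rightarrow> (nat \<Rightarrow> nat) \<Rightarrow> (nat \<Rightarrow> nat) \<Rightarrow> real" where
  "osc_basis d m u i = (\<Prod>c\<in>{1..d}. osc (m c) (i c) (u c))"

definition osc_freq :: "(nat \<Rightarrow> nat) \<Rightarrow> (nat \<Rightarrow> real) \<Rightarrow> (nat \<Rightarrow> nat) \<Rightarrow> nat \<Rightarrow> real" where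
  "osc_freq m a i c = - 2 * a c * cos (real (i c) * pi / real (m c + 1))"

lemma osc_basis_update:
  assumes "c \<in> {1..d}"
  shows "osc_basis d m (u(c := k)) i = osc (m c) (i c) k * (\<Prod>c'\<in>{1..d} - {c}. osc (m c') (i c') (u c'))"
proof -
  have "(\<Prod>c'\<in>{1..d} - {c}. osc (m c') (i c') ((u(c := k)) c')) = (\<Prod>c'\<in>{1..d} - {c}. osc (m c') (i c') (u c'))"
    by (rule prod.cong) auto
  then show ?thesis
    using prod.remove[OF _ assms, of "\<lambda>c'. osc (m c') (i c') ((u(c := k)) c')"] by (simp add: osc_basis_def)
qed

lemma kasteleyn_twisted_basis:
  assumes u: "u \<in> grid_vertices d m"
  shows "(\<Sum>v\<in>grid_vertices d m. kasteleyn d 0 a u v * (tail_sign d b v * osc_basis d m v i))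
    = (\<Sum>c\<in>{1..d}. (if b < c then -1 else 1) * osc_freq m a i c * tail_sign d (c - 1) u * tail_sign d b u * osc_basis d m u i)"
proof -
  define F where "F = (\<lambda>v. tail_sign d b v * osc_basis d m v i)"
  have "(\<Sum>v\<in>grid_vertices d m. kasteleyn d 0 a u v * F v)
    = (\<Sum>c\<in>{1..d}. a c * tail_sign d c u * (F (u(c := u c + 1)) - F (u(c := u c - 1))))"
  proof (rule kasteleyn_apply[OF u])
    fix c assume "c \<in> {1..d}"
    then show "F (u(c := 0)) = 0" "F (u(c := m c + 1)) = 0"
      unfolding F_def by (simp_all only: osc_basis_update osc_zero osc_end mult_zero_left mult_zero_right)
  qed
  also have "\<dots> = (\<Sum>c\<in>{1..d}. (if b < c then -1 else 1) * osc_freq m a i c * tail_sign d (c - 1) u * tail_sign d b u * osc_basis d m u i)"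
  proof (rule sum.cong[OF refl])
    fix c assume c: "c \<in> {1..d}"
    then have pos: "1 \<le> u c" using u by (auto simp: grid_vertices_def PiE_def Pi_def)
    define \<kappa> where "\<kappa> = (if b < c then -1 else (1::real))"
    define R where "R = (\<Prod>c'\<in>{1..d} - {c}. osc (m c') (i c') (u c'))"
    define h where "h = (\<lambda>k. osc (m c) (i c) k)"
    have E: "osc_basis d m u i = h (u c) * R"
      using osc_basis_update[OF c, of m u "u c" i] by (simp add: h_def R_def)
    have "F (u(c := u c + 1)) - F (u(c := u c - 1)) = \<kappa> * tail_sign d b u * (h (u c + 1) - h (u c - 1)) * R"
    proof -
      have odd: "odd (u c + 1 + u c)" "odd (u c - 1 + u c)" using pos by auto
      have "tail_sign d b (u(c := u c + 1)) = \<kappa> * tail_sign d b u" "tail_sign d b (u(c := u c - 1)) = \<kappa> * tail_sign d b u"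
        unfolding \<kappa>_def
        using tail_sign_update[of c d "u c + 1" u b] tail_sign_update[of c d "u c - 1" u b] c odd by blast+
      then show ?thesis
        unfolding F_def osc_basis_update[OF c] h_def R_def by (simp add: algebra_simps)
    qed
    also have "h (u c + 1) - h (u c - 1) = 2 * cos (real (i c) * pi / real (m c + 1)) * (-1) ^ u c * h (u c)"
      unfolding h_def by (rule osc_step[OF pos])
    finally have diff: "F (u(c := u c + 1)) - F (u(c := u c - 1))
      = \<kappa> * tail_sign d b u * (2 * cos (real (i c) * pi / real (m c + 1)) * (-1) ^ u c * h (u c)) * R" .
    show "a c * tail_sign d c u * (F (u(c := u c + 1)) - F (u(c := u c - 1)))
      = (if b < c then -1 else 1) * osc_freq m a i c * tail_sign d (c - 1) u * tail_sign d b u * osc_basis d m u i"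
      unfolding diff E \<kappa>_def[symmetric] tail_sign_pred[OF c] osc_freq_def by (simp add: algebra_simps)
  qed
  finally show ?thesis by (simp add: F_def)
qed

lemma sum_anticommuting:
  fixes w :: "nat \<Rightarrow> nat \<Rightarrow> real"
  assumes "finite A" "\<And>b c. w b c = w c b"
  shows "(\<Sum>b\<in>A. \<Sum>c\<in>A. (if b \<le> c then -1 else 1) * w b c) = - (\<Sum>b\<in>A. w b b)"
proof -
  define s where "s = (\<lambda>b c :: nat. if b < c then -1 else if c < b then 1 else (0::real))"
  have "(\<Sum>b\<in>A. \<Sum>c\<in>A. s b c * w b c) = (\<Sum>b\<in>A. \<Sum>c\<in>A. s c b * w c b)"
    by (rule sum.swap)
  also have "\<dots> = (\<Sum>b\<in>A. \<Sum>c\<in>A. - (s b c * w b c))"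
    by (intro sum.cong) (auto simp: s_def assms(2))
  finally have zero: "(\<Sum>b\<in>A. \<Sum>c\<in>A. s b c * w b c) = 0" by (simp add: sum_negf)
  have "(\<Sum>b\<in>A. \<Sum>c\<in>A. (if b \<le> c then -1 else 1) * w b c)
    = (\<Sum>b\<in>A. \<Sum>c\<in>A. s b c * w b c - (if b = c then w b b else 0))"
    by (intro sum.cong) (auto simp: s_def)
  also have "\<dots> = - (\<Sum>b\<in>A. w b b)"
    using assms(1) zero by (simp add: sum_subtractf)
  finally show ?thesis .
qed

lemma tail_sign_full: "tail_sign d d u = 1"
  by (simp add: tail_sign_def)

text \<open>The coordinate parts of the matrix anticommute, so only their squares survive.\<close>
lemma kasteleyn_square_basis:
  assumes u: "u \<in> grid_vertices d m"
  shows "(\<Sum>v\<in>grid_vertices d m. kasteleyn d x a v u * (\<Sum>w\<in>grid_vertices d m. kasteleyn d x a v w * osc_basis d m w i))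
    = (x\<^sup>2 + (\<Sum>c\<in>{1..d}. (osc_freq m a i c)\<^sup>2)) * osc_basis d m u i"
proof -
  define V where "V = grid_vertices d m"
  define K where "K = kasteleyn d 0 a"
  define E where "E = (\<lambda>v. osc_basis d m v i)"
  define fq where "fq = osc_freq m a i"
  define Y where "Y = (\<lambda>v. \<Sum>c\<in>{1..d}. fq c * (tail_sign d (c - 1) v * E v))"
  have fin: "finite V" by (simp add: V_def finite_grid_vertices)
  have diag: "(\<Sum>w\<in>V. (if v = w then x else 0) * f w) = x * f v" if "v \<in> V" for f :: "(nat \<Rightarrow> nat) \<Rightarrow> real" and v
    using fin that by (simp add: sum.delta if_distrib[of "\<lambda>t. t * _"] cong: if_cong)
  have KE: "(\<Sum>w\<in>V. K v w * E w) = Y v" if "v \<in> V" for v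
    using kasteleyn_twisted_basis[of v d m a d i] that
    by (simp add: tail_sign_full V_def K_def E_def Y_def fq_def mult.assoc)
  have KY: "(\<Sum>v\<in>V. K u v * Y v) = - (\<Sum>c\<in>{1..d}. (fq c)\<^sup>2) * E u"
  proof -
    define w where "w = (\<lambda>b c. fq b * fq c * tail_sign d (b - 1) u * tail_sign d (c - 1) u * E u)"
    have "(\<Sum>v\<in>V. K u v * Y v) = (\<Sum>b\<in>{1..d}. fq b * (\<Sum>v\<in>V. K u v * (tail_sign d (b - 1) v * E v)))"
      unfolding Y_def sum_distrib_left by (subst sum.swap) (simp add: algebra_simps)
    also have "\<dots> = (\<Sum>b\<in>{1..d}. \<Sum>c\<in>{1..d}. (if b \<le> c then -1 else 1) * w b c)"
    proof (rule sum.cong[OF refl])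
      fix b assume b: "b \<in> {1..d}"
      have "(\<Sum>v\<in>V. K u v * (tail_sign d (b - 1) v * E v))
        = (\<Sum>c\<in>{1..d}. (if b - 1 < c then -1 else 1) * fq c * tail_sign d (c - 1) u * tail_sign d (b - 1) u * E u)"
        unfolding V_def K_def E_def fq_def by (rule kasteleyn_twisted_basis[OF u])
      then show "fq b * (\<Sum>v\<in>V. K u v * (tail_sign d (b - 1) v * E v)) = (\<Sum>c\<in>{1..d}. (if b \<le> c then -1 else 1) * w b c)"
        using b by (simp only: sum_distrib_left) (auto simp: w_def intro!: sum.cong)
    qed
    also have "\<dots> = - (\<Sum>b\<in>{1..d}. w b b)"
      by (rule sum_anticommuting) (simp_all add: w_def mult_ac)
    also have "(\<Sum>b\<in>{1..d}. w b b) = (\<Sum>b\<in>{1..d}. (fq b)\<^sup>2) * E u"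
      unfolding sum_distrib_right
    proof (rule sum.cong[OF refl])
      fix b
      have "w b b = fq b * fq b * (tail_sign d (b - 1) u * tail_sign d (b - 1) u) * E u"
        by (simp only: w_def mult_ac)
      then show "w b b = (fq b)\<^sup>2 * E u" by (simp add: tail_sign_square power2_eq_square)
    qed
    finally show ?thesis by simp
  qed
  have "(\<Sum>v\<in>V. kasteleyn d x a v u * (\<Sum>w\<in>V. kasteleyn d x a v w * E w))
    = (\<Sum>v\<in>V. ((if u = v then x else 0) - K u v) * (x * E v + Y v))"
  proof (rule sum.cong[OF refl])
    fix v assume v: "v \<in> V"
    have "(\<Sum>w\<in>V. kasteleyn d x a v w * E w) = x * E v + Y v"
      using diag[OF v, of E] KE[OF v] by (simp add: kasteleyn_split[of d x] K_def distrib_right sum.distrib)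
    moreover have "kasteleyn d x a v u = (if u = v then x else 0) - K u v"
      unfolding kasteleyn_split[of d x a v u] K_def kasteleyn_antisym[of d a v u] by auto
    ultimately show "kasteleyn d x a v u * (\<Sum>w\<in>V. kasteleyn d x a v w * E w)
      = ((if u = v then x else 0) - K u v) * (x * E v + Y v)" by simp
  qed
  also have "\<dots> = (\<Sum>v\<in>V. (if u = v then x else 0) * (x * E v + Y v)) - (x * (\<Sum>v\<in>V. K u v * E v) + (\<Sum>v\<in>V. K u v * Y v))"
  proof -
    have "(e - K u v) * (x * E v + Y v) = e * (x * E v + Y v) - (x * (K u v * E v) + K u v * Y v)" for e v
      by (simp add: algebra_simps)
    then show ?thesis by (simp only: sum_subtractf sum.distrib sum_distrib_left)
  qed
  also have "\<dots> = x * (x * E u + Y u) - (x * Y u + (- (\<Sum>c\<in>{1..d}. (fq c)\<^sup>2) * E u))"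
    using u by (simp only: diag KE KY V_def[symmetric])
  also have "\<dots> = (x\<^sup>2 + (\<Sum>c\<in>{1..d}. (fq c)\<^sup>2)) * E u"
    by (simp add: algebra_simps power2_eq_square)
  finally show ?thesis by (simp add: V_def E_def fq_def)
qed

lemma osc_basis_orthogonal:
  assumes "i \<in> grid_vertices d m" "j \<in> grid_vertices d m"
  shows "(\<Sum>u\<in>grid_vertices d m. osc_basis d m u i * osc_basis d m u j)
    = (if i = j then (\<Prod>c\<in>{1..d}. real (m c + 1) / 2) else 0)"
proof -
  have "(\<Sum>u\<in>grid_vertices d m. osc_basis d m u i * osc_basis d m u j)
    = (\<Prod>c\<in>{1..d}. \<Sum>k\<in>{1..m c}. osc (m c) (i c) k * osc (m c) (j c) k)"
    unfolding osc_basis_def grid_vertices_def prod.distrib[symmetric] by (rule prod_sum_PiE[symmetric]) auto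
  also have "\<dots> = (\<Prod>c\<in>{1..d}. if i c = j c then real (m c + 1) / 2 else 0)"
    using assms by (intro prod.cong osc_orthogonal) (auto simp: grid_vertices_def PiE_def Pi_def)
  also have "\<dots> = (if i = j then (\<Prod>c\<in>{1..d}. real (m c + 1) / 2) else 0)"
  proof (cases "i = j")
    case False
    then obtain c where "c \<in> {1..d}" "i c \<noteq> j c"
      using assms PiE_ext[of i "{1..d}" "\<lambda>c. {1..m c}" j] by (auto simp: grid_vertices_def)
    then have "(\<Prod>c\<in>{1..d}. if i c = j c then real (m c + 1) / 2 else 0) = 0"
      by (intro prod_zero) auto
    then show ?thesis using False by simp
  qed simp
  finally show ?thesis .
qed

lemma set_det_kasteleyn_square:
  "(set_det (grid_vertices d m) (kasteleyn d x a))\<^sup>2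
    = (\<Prod>i\<in>grid_vertices d m. x\<^sup>2 + (\<Sum>c\<in>{1..d}. (osc_freq m a i c)\<^sup>2))"
proof -
  define V where "V = grid_vertices d m"
  define K where "K = kasteleyn d x a"
  define Q where "Q = osc_basis d m"
  define D where "D = (\<lambda>i. x\<^sup>2 + (\<Sum>c\<in>{1..d}. (osc_freq m a i c)\<^sup>2))"
  have fin: "finite V" by (simp add: V_def finite_grid_vertices)
  have "set_det V (\<lambda>i j. \<Sum>u\<in>V. Q u i * Q u j)
    = set_det V (\<lambda>i j. if i = j then (\<Prod>c\<in>{1..d}. real (m c + 1) / 2) else 0)"
    unfolding V_def Q_def by (rule set_det_cong) (rule osc_basis_orthogonal)
  also have "\<dots> = (\<Prod>v\<in>V. \<Prod>c\<in>{1..d}. real (m c + 1) / 2)" by (rule set_det_diagonal[OF fin])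
  finally have "set_det V (\<lambda>i u. Q u i) * set_det V Q \<noteq> 0"
    unfolding set_det_mult[OF fin] using fin by simp
  then have Q: "set_det V Q \<noteq> 0" by simp
  have "set_det V (\<lambda>u i. \<Sum>v\<in>V. K v u * (\<Sum>w\<in>V. K v w * Q w i))
    = set_det V (\<lambda>u i. \<Sum>j\<in>V. Q u j * (if j = i then D j else 0))"
  proof (rule set_det_cong)
    fix u i assume ui: "u \<in> V" "i \<in> V"
    have "(\<Sum>v\<in>V. K v u * (\<Sum>w\<in>V. K v w * Q w i)) = D i * Q u i"
      using ui(1) unfolding V_def K_def Q_def D_def by (rule kasteleyn_square_basis)
    then show "(\<Sum>v\<in>V. K v u * (\<Sum>w\<in>V. K v w * Q w i)) = (\<Sum>j\<in>V. Q u j * (if j = i then D j else 0))"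
      using fin ui(2) by (simp add: sum.delta' if_distrib[of "\<lambda>t. _ * t"] mult.commute cong: if_cong)
  qed
  moreover have "set_det V (\<lambda>u i. \<Sum>v\<in>V. K v u * (\<Sum>w\<in>V. K v w * Q w i))
    = set_det V (\<lambda>u v. K v u) * set_det V (\<lambda>v i. \<Sum>w\<in>V. K v w * Q w i)"
    by (rule set_det_mult[OF fin, of "\<lambda>u v. K v u" "\<lambda>v i. \<Sum>w\<in>V. K v w * Q w i"])
  moreover have "set_det V (\<lambda>u v. K v u) = set_det V K" by (rule set_det_transpose[OF fin])
  moreover have "set_det V (\<lambda>v i. \<Sum>w\<in>V. K v w * Q w i) = set_det V K * set_det V Q"
    by (rule set_det_mult[OF fin])
  moreover have "set_det V (\<lambda>u i. \<Sum>j\<in>V. Q u j * (if j = i then D j else 0))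
    = set_det V Q * set_det V (\<lambda>j i. if j = i then D j else 0)"
    by (rule set_det_mult[OF fin])
  moreover have "set_det V (\<lambda>j i. if j = i then D j else 0) = (\<Prod>i\<in>V. D i)"
    by (rule set_det_diagonal[OF fin])
  ultimately have "set_det V K * (set_det V K * set_det V Q) = set_det V Q * (\<Prod>i\<in>V. D i)" by metis
  then have "(set_det V K)\<^sup>2 = (\<Prod>i\<in>V. D i)" using Q by (simp add: power2_eq_square)
  then show ?thesis by (simp add: V_def K_def D_def)
qed

theorem theorem6p1:
  fixes d l :: nat and m :: "nat \<Rightarrow> nat" and x :: real and a :: "nat \<Rightarrow> real"
  assumes "d \<ge> 2"
    and "\<forall>i\<in>{1..d}. m i > 0"
    and "l \<le> d"
    and "\<forall>i\<in>{1..l}. odd (m i)"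
    and "\<forall>i\<in>{l+1..d}. even (m i)"
  shows "md_partition_function d m x a =
    (\<Prod>S\<in>Pow {1..l}. if card S = d then x else (T_S d m x a S) ^ (2 ^ (d - 1 - card S)))"
proof -
  define V where "V = grid_vertices d m"
  define t where "t = (\<lambda>c k. 4 * (a c)\<^sup>2 * (cos (real k * pi / real (m c + 1)))\<^sup>2)"
  define T where "T = (\<lambda>S. \<Prod>i\<in>PiE ({1..d} - S) (\<lambda>p. {1..m p div 2}). [:\<Sum>p\<in>{1..d} - S. t p (i p), 0, 1:])"
  define q where "q = (\<Prod>S\<in>Pow {1..l}. if card S = d then [:0, 1:] else T S ^ (2 ^ (d - 1 - card S)))"
  have fin: "finite V" by (simp add: V_def finite_grid_vertices)
  have poly_T: "poly (T S) y = T_S d m y a S" for S y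
    by (simp add: T_def T_S_def poly_prod t_def power2_eq_square algebra_simps)
  have poly_q: "poly q y = (\<Prod>S\<in>Pow {1..l}. if card S = d then y else (T_S d m y a S) ^ (2 ^ (d - 1 - card S)))" for y
    unfolding q_def poly_prod by (rule prod.cong[OF refl]) (simp add: poly_T)
  have "lead_coeff (T S) = 1" for S
    by (simp add: T_def lead_coeff_prod)
  then have lead_q: "lead_coeff q = 1"
    unfolding q_def lead_coeff_prod by (intro prod.neutral) (simp add: lead_coeff_power)
  obtain p where p: "lead_coeff p = 1" "\<And>y. set_det V (kasteleyn d y a) = poly p y"
    using set_det_monic_poly[OF fin, of "kasteleyn d 0 a"] unfolding kasteleyn_split[symmetric] by blast
  have freq: "(osc_freq m a i c)\<^sup>2 = t c (i c)" for i c
    by (simp add: osc_freq_def t_def power_mult_distrib)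
  have reflect: "t c (m c + 1 - k) = t c k" if "k \<in> {1..m c}" for c k
  proof -
    have "real (m c + 1 - k) * pi / real (m c + 1) = pi - real k * pi / real (m c + 1)"
      using that by (simp add: of_nat_diff field_simps)
    then show ?thesis by (simp add: t_def)
  qed
  have middle: "t c ((m c + 1) div 2) = 0" if "odd (m c)" for c
  proof -
    have "real ((m c + 1) div 2) * pi / real (m c + 1) = pi / 2"
      using that by (auto elim!: oddE simp: field_simps)
    then show ?thesis unfolding t_def by (simp only: cos_pi_half) simp
  qed
  have odd_set: "{c\<in>{1..d}. odd (m c)} = {1..l}"
  proof (intro equalityI subsetI)
    fix c assume c: "c \<in> {c\<in>{1..d}. odd (m c)}"
    then have "c \<notin> {l+1..d}" using assms(5) by blast
    then show "c \<in> {1..l}" using c by auto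
  next
    fix c assume "c \<in> {1..l}"
    then show "c \<in> {c\<in>{1..d}. odd (m c)}" using assms(3,4) by auto
  qed
  have "(poly p y)\<^sup>2 = (poly q y)\<^sup>2" for y
  proof -
    have "(poly p y)\<^sup>2 = (\<Prod>i\<in>V. y\<^sup>2 + (\<Sum>c\<in>{1..d}. t c (i c)))"
      unfolding p(2)[symmetric] V_def by (simp only: set_det_kasteleyn_square freq)
    also have "\<dots> = (\<Prod>S\<in>Pow {1..l}. (T_S d m y a S) ^ 2 ^ (d - card S))"
      using prod_PiE_fold[of "{1..d}" m t "y\<^sup>2"] reflect middle
      unfolding odd_set by (simp add: V_def grid_vertices_def T_S_def t_def)
    also have "\<dots> = (\<Prod>S\<in>Pow {1..l}. (if card S = d then y else (T_S d m y a S) ^ (2 ^ (d - 1 - card S)))\<^sup>2)"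
    proof (rule prod.cong[OF refl])
      fix S assume "S \<in> Pow {1..l}"
      then have S: "S \<subseteq> {1..d}" using assms(3) by auto
      then have "card S \<le> d" using card_mono[OF _ S] by simp
      show "(T_S d m y a S) ^ 2 ^ (d - card S) = (if card S = d then y else (T_S d m y a S) ^ (2 ^ (d - 1 - card S)))\<^sup>2"
      proof (cases "card S = d")
        case True
        then have "S = {1..d}" using card_subset_eq[OF _ S] by simp
        then show ?thesis by (simp add: T_S_def)
      next
        case False
        then have "d - card S = Suc (d - 1 - card S)" using \<open>card S \<le> d\<close> by simp
        then show ?thesis using False by (simp add: power_mult[symmetric] mult.commute)
      qed
    qed
    finally show ?thesis unfolding poly_q by (simp add: prod_power_distrib)
  qed
  then have "p = q" by (intro monic_poly_eqI p(1) lead_q)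
  have "md_partition_function d m x a = set_det V (kasteleyn d x a)"
    unfolding md_partition_function_eq_leibniz[OF assms(1)] set_det_def V_def ..
  then show ?thesis using p(2) \<open>p = q\<close> poly_q by simp
qed

end
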